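(* Let $n$ be an integer and $g$ odd with $3\le g<n$, and let $\gamma$ be an integer with $\lceil g/3\rceil\le\gamma\le\gamma_g$. Among all connected non-bipartite graphs of order $n$ with domination number $\gamma$ in which the minimum length of an odd cycle is $g$, the graph $V_n^\gamma(g)$ is the unique one attaining the minimum value of $q_{\min}$.
   Context: All graphs are finite and simple. For a graph $G$ with degree diagonal matrix $D(G)$ and adjacency matrix $A(G)$, the signless Laplacian is $Q(G)=D(G)+A(G)$, and $q_{\min}(G)$ denotes its least eigenvalue. The domination number $\gamma(G)$ is the minimum size of a set $S\subseteq V(G)$ such that every vertex outside $S$ has a neighbor in $S$. For odd $g$ with $3\le g<n$ and $1\le k\le n-g$, $U_n^k(g)$ denotes the unicyclic graph on $n$ vertices obtained from a cycle $C_g$ and a star $S_{1,k}$ (center plus $k$ leaves) by joining a vertex of the cycle to the center of the star by a path $P_l$ on $l=n+1-g-k$ vertices, the endpoints of the path being identified with the cycle vertex and the star center respectively (when $l=1$ the cycle vertex and the star center are identified). Let $\gamma_g=\gamma(U_n^1(g))$. For each integer $\gamma$ with $\lceil g/3\rceil\le\gamma\le\gamma_g$ there is at least one $k$ with $\gamma(U_n^k(g))=\gamma$, and $V_n^\gamma(g)$ denotes $U_n^k(g)$ for the minimum such $k$. *)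

theory Defs
  imports "Graph_Theory.Graph_Theory" "Jordan_Normal_Form.Spectral_Radius"
begin

text \<open>
  Finite simple graphs are the \<open>pair_graph\<close>s of \<open>Graph_Theory\<close>: a finite vertex set with a
  symmetric irreflexive arc relation, an edge \<open>{u, v}\<close> being the pair of arcs \<open>(u, v)\<close>, \<open>(v, u)\<close>.
  In particular the degree of a vertex is its out-degree.
\<close>

text \<open>
  Matrices are indexed by \<open>{0..<n}\<close>, so the vertices have to be enumerated. A different
  enumeration conjugates the matrices below by a permutation matrix, which leaves the spectrum
  unchanged.
\<close>

definition vertex_list :: "'a pair_pre_digraph \<Rightarrow> 'a list" where
  "vertex_list G = (SOME vs. distinct vs \<and> set vs = pverts G)"

definition adjacency_matrix :: "'a pair_pre_digraph \<Rightarrow> real mat" where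
  "adjacency_matrix G = (let vs = vertex_list G; n = card (pverts G) in
     mat n n (\<lambda>(i, j). if (vs ! i, vs ! j) \<in> parcs G then 1 else 0))"

definition degree_matrix :: "'a pair_pre_digraph \<Rightarrow> real mat" where
  "degree_matrix G = (let vs = vertex_list G; n = card (pverts G) in
     mat n n (\<lambda>(i, j). if i = j then real (out_degree G (vs ! i)) else 0))"

definition signless_laplacian :: "'a pair_pre_digraph \<Rightarrow> real mat" where
  "signless_laplacian G = degree_matrix G + adjacency_matrix G"

text \<open>
  The matrix is real symmetric, so all its eigenvalues are real and nothing is lost by taking
  the spectrum over the reals.
\<close>

definition q_min :: "'a pair_pre_digraph \<Rightarrow> real" where
  "q_min G = Min (spectrum (signless_laplacian G))"

definition dominating_set :: "'a pair_pre_digraph \<Rightarrow> 'a set \<Rightarrow> bool" where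
  "dominating_set G S \<longleftrightarrow>
     S \<subseteq> pverts G \<and> (\<forall>v \<in> pverts G - S. \<exists>u \<in> S. (v, u) \<in> parcs G)"

definition domination_number :: "'a pair_pre_digraph \<Rightarrow> nat" where
  "domination_number G = Min (card ` {S. dominating_set G S})"

definition bipartite :: "'a pair_pre_digraph \<Rightarrow> bool" where
  "bipartite G \<longleftrightarrow> (\<exists>A B. A \<union> B = pverts G \<and> A \<inter> B = {} \<and>
     parcs G \<subseteq> A \<times> B \<union> B \<times> A)"

text \<open>
  The cycles of \<open>Graph_Theory\<close> include the closed walks \<open>u, v, u\<close> of length 2, but in a loop-free
  graph those of odd length are exactly the odd cycles of the underlying simple graph.
\<close>

definition odd_girth :: "'a pair_pre_digraph \<Rightarrow> nat" where
  "odd_girth G = (LEAST m. odd m \<and> (\<exists>p. pre_digraph.cycle G p \<and> length p = m))"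

definition nonbipartite_class :: "nat \<Rightarrow> nat \<Rightarrow> nat \<Rightarrow> 'a pair_pre_digraph set" where
  "nonbipartite_class n \<gamma> g = {G. pair_graph G \<and> Digraph_Component.connected G \<and>
     \<not> bipartite G \<and> card (pverts G) = n \<and> domination_number G = \<gamma> \<and> odd_girth G = g}"

text \<open>
  \<open>U n k g\<close> for \<open>3 \<le> g < n\<close> and \<open>1 \<le> k \<le> n - g\<close>: the cycle is on \<open>0, \<dots>, g - 1\<close>, the joining path
  on the \<open>n + 1 - g - k\<close> vertices \<open>g - 1, \<dots>, n - k - 1\<close>, the star has centre \<open>n - k - 1\<close> and
  leaves \<open>n - k, \<dots>, n - 1\<close>.
\<close>

definition U :: "nat \<Rightarrow> nat \<Rightarrow> nat \<Rightarrow> nat pair_pre_digraph" where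
  "U n k g =
    (let cycle_edges = {(i, i + 1) | i. i < g - 1} \<union> {(g - 1, 0)};
         path_edges = {(i, i + 1) | i. g - 1 \<le> i \<and> i < n - k - 1};
         star_edges = {(n - k - 1, j) | j. n - k \<le> j \<and> j < n};
         E = cycle_edges \<union> path_edges \<union> star_edges
     in \<lparr> pverts = {0..<n}, parcs = E \<union> E\<inverse> \<rparr>)"

definition V :: "nat \<Rightarrow> nat \<Rightarrow> nat \<Rightarrow> nat pair_pre_digraph" where
  "V n \<gamma> g = U n (LEAST k. 1 \<le> k \<and> k \<le> n - g \<and> domination_number (U n k g) = \<gamma>) g"

end

theory Submission
  imports Defs "HOL-Analysis.Function_Topology"
begin

text \<open>
  Let \<open>S\<close> be a minimum dominating set of \<open>G\<close>, let \<open>C\<close> be a shortest odd cycle meeting \<open>S\<close> in as many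
  vertices as possible, let \<open>x\<close> be an eigenvector for the least eigenvalue, and let \<open>z\<close> maximize
  \<open>\<bar>x\<bar>\<close> on \<open>S\<close>. Join \<open>C\<close> to \<open>z\<close> by a path with as few edges as possible that do not join a vertex
  to its dominator. Every vertex outside this lollipop is now hung on \<open>z\<close> as a leaf: a vertex of \<open>S\<close>
  gets the value \<open>-x(z)\<close>, any other vertex \<open>v\<close> a value that preserves the contribution
  \<open>(x(v) + x(s(v)))\<^sup>2\<close> of the edge to its dominator \<open>s(v)\<close>. Absolute values do not decrease, because
  \<open>\<bar>x(s(v))\<bar> \<le> \<bar>x(z)\<bar>\<close>, so the Rayleigh quotient does not increase. The choice of \<open>C\<close> and of the path
  makes the dominators outside the lollipop serve at most one vertex of it each, so that the
  resulting \<open>U n k g\<close> has domination number at most \<open>card S\<close>.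

  The domination number of \<open>U n k g\<close> exceeds that of \<open>U n (k + 1) g\<close> by at most one, hence
  this \<open>k\<close> is at least the one defining \<open>V n \<gamma> g\<close>, and \<open>q_min (U n k g)\<close> is strictly increasing
  in \<open>k\<close>. For uniqueness, the absolute values of a minimizer on \<open>U n k g\<close> are symmetric on the cycle and
  strictly increase from the edge opposite to the attachment vertex up to the leaves; thus no two
  vertices have opposite values, and \<open>G\<close> has no further edges.
\<close>

section \<open>The Rayleigh principle for the signless Laplacian\<close>

text \<open>The quadratic form of the signless Laplacian. Every edge occurs as two arcs, hence the
  division by 2.\<close>

definition qform :: "'a pair_pre_digraph \<Rightarrow> ('a \<Rightarrow> real) \<Rightarrow> real" where
  "qform G x = (\<Sum>(u, v)\<in>parcs G. (x u + x v)\<^sup>2) / 2"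

definition sqnorm :: "'a pair_pre_digraph \<Rightarrow> ('a \<Rightarrow> real) \<Rightarrow> real" where
  "sqnorm G x = (\<Sum>v\<in>pverts G. (x v)\<^sup>2)"

lemma qform_nonneg: "0 \<le> qform G x"
  unfolding qform_def by (intro divide_nonneg_nonneg sum_nonneg) auto

lemma sqnorm_nonneg: "0 \<le> sqnorm G x"
  unfolding sqnorm_def by (intro sum_nonneg) auto

lemma sqnorm_eq_0_iff:
  "finite (pverts G) \<Longrightarrow> sqnorm G x = 0 \<longleftrightarrow> (\<forall>v\<in>pverts G. x v = 0)"
  unfolding sqnorm_def by (subst sum_nonneg_eq_0_iff) auto

lemma sqnorm_pos:
  assumes "finite (pverts G)" "v \<in> pverts G" "x v \<noteq> 0"
  shows "0 < sqnorm G x"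
  using assms sqnorm_nonneg[of G x] sqnorm_eq_0_iff[of G x] by (metis order_le_less)

lemma qform_scale: "qform G (\<lambda>v. c * x v) = c\<^sup>2 * qform G x"
proof -
  have "(\<lambda>(u, v). (c * x u + c * x v)\<^sup>2) = (\<lambda>(u, v). c\<^sup>2 * (x u + x v)\<^sup>2)"
    by (auto simp: power2_eq_square algebra_simps)
  then show ?thesis
    unfolding qform_def by (simp add: sum_distrib_left case_prod_unfold)
qed

lemma sqnorm_scale: "sqnorm G (\<lambda>v. c * x v) = c\<^sup>2 * sqnorm G x"
  unfolding sqnorm_def by (simp add: sum_distrib_left power_mult_distrib)

lemma qform_cong:
  assumes "pair_graph G" "\<And>v. v \<in> pverts G \<Longrightarrow> x v = y v"
  shows "qform G x = qform G y"
proof -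
  interpret pair_graph G by fact
  show ?thesis
    unfolding qform_def
    by (intro arg_cong[where f = "\<lambda>t. t / 2"] sum.cong)
      (auto, metis assms(2) in_arcsD1 in_arcsD2)
qed

lemma qform_parallelogram:
  "qform G (\<lambda>v. x v - y v) + qform G (\<lambda>v. x v + y v) = 2 * qform G x + 2 * qform G y"
proof -
  have "(\<Sum>p\<in>parcs G. (x (fst p) - y (fst p) + (x (snd p) - y (snd p)))\<^sup>2)
      + (\<Sum>p\<in>parcs G. (x (fst p) + y (fst p) + (x (snd p) + y (snd p)))\<^sup>2)
      = 2 * (\<Sum>p\<in>parcs G. (x (fst p) + x (snd p))\<^sup>2)
      + 2 * (\<Sum>p\<in>parcs G. (y (fst p) + y (snd p))\<^sup>2)"
    unfolding sum_distrib_left sum.distrib[symmetric]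
    by (intro sum.cong refl) (simp add: power2_eq_square algebra_simps)
  then show ?thesis
    unfolding qform_def case_prod_unfold by linarith
qed

lemma sqnorm_parallelogram:
  "sqnorm G (\<lambda>v. x v - y v) + sqnorm G (\<lambda>v. x v + y v) = 2 * sqnorm G x + 2 * sqnorm G y"
  unfolding sqnorm_def sum_distrib_left sum.distrib[symmetric]
  by (intro sum.cong refl) (simp add: power2_eq_square algebra_simps)

lemma rayleigh_minimum_exists:
  assumes G: "pair_graph G" and ne: "pverts G \<noteq> {}"
  shows "\<exists>q. (\<forall>x. q * sqnorm G x \<le> qform G x) \<and> (\<exists>x. sqnorm G x = 1 \<and> qform G x = q)"
proof -
  interpret pair_graph G by fact
  define K where "K = (Pi\<^sub>E UNIV (\<lambda>i. if i \<in> pverts G then {-1..1} else {0::real}))"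
  have "compactin (product_topology (\<lambda>i. euclidean) UNIV) K"
    unfolding K_def by (subst compactin_PiE) auto
  then have "compact K"
    by (simp add: euclidean_product_topology)
  moreover have cn: "continuous_on UNIV (sqnorm G)"
    unfolding sqnorm_def by (intro continuous_intros continuous_on_product_coordinates)
  then have "closed {x. sqnorm G x = 1}"
    using continuous_closed_preimage_constant[of UNIV "sqnorm G" 1] by simp
  ultimately have cK: "compact (K \<inter> {x. sqnorm G x = 1})"
    by (rule compact_Int_closed)
  have cq: "continuous_on (K \<inter> {x. sqnorm G x = 1}) (qform G)"
    unfolding qform_def case_prod_unfold
    by (rule continuous_on_subset[of UNIV])
      (auto intro!: continuous_intros continuous_on_product_coordinates)
  obtain r where r: "r \<in> pverts G" using ne by auto
  have nK: "(\<lambda>u. if u = r then 1 else 0) \<in> K \<inter> {x. sqnorm G x = 1}"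
    using r by (auto simp: K_def sqnorm_def if_distribR if_distrib[of "\<lambda>t. t\<^sup>2"] pair_finite_verts cong: if_cong)
  obtain x where x: "x \<in> K" "sqnorm G x = 1"
    and min: "\<And>y. y \<in> K \<Longrightarrow> sqnorm G y = 1 \<Longrightarrow> qform G x \<le> qform G y"
    using continuous_attains_inf[OF cK _ cq] nK by blast
  have "qform G x * sqnorm G y \<le> qform G y" for y
  proof (cases "sqnorm G y = 0")
    case True
    then show ?thesis using qform_nonneg by simp
  next
    case False
    then have pos: "sqnorm G y > 0" using sqnorm_nonneg[of G y] by simp
    \<comment> \<open>\<open>y\<close> is cleared off the vertices and scaled to norm 1. It becomes
      a competitor in \<open>K\<close> with the same Rayleigh quotient.\<close>
    define z where "z = (\<lambda>v. (1 / sqrt (sqnorm G y)) * (if v \<in> pverts G then y v else 0))"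
    have s1: "sqnorm G (\<lambda>v. if v \<in> pverts G then y v else 0) = sqnorm G y"
      by (simp add: sqnorm_def)
    have nz: "sqnorm G z = 1"
      unfolding z_def sqnorm_scale s1 using pos by (simp add: power_divide)
    have "z v \<in> {-1..1}" if "v \<in> pverts G" for v
    proof -
      have "(z v)\<^sup>2 \<le> sqnorm G z"
        unfolding sqnorm_def using that
        by (intro member_le_sum) (auto simp: pair_finite_verts)
      then show ?thesis using nz by (simp add: abs_square_le_1 abs_le_iff)
    qed
    moreover have "z v = 0" if "v \<notin> pverts G" for v
      using that by (simp add: z_def)
    ultimately have "z \<in> K"
      by (simp add: K_def PiE_UNIV_domain)
    then have "qform G x \<le> qform G z" using min nz by blast
    also have "qform G z = qform G y / sqnorm G y"
      unfolding z_def qform_scale using pos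
      by (subst qform_cong[OF G, of _ y]) (auto simp: power_divide)
    finally show ?thesis using pos by (simp add: field_simps)
  qed
  then show ?thesis using x by blast
qed

section \<open>The eigenvector equation of a minimizer\<close>

lemma sum_arcs_indicator:
  fixes f :: "'a \<Rightarrow> 'a \<Rightarrow> real"
  assumes "finite (parcs G)"
  shows "(\<Sum>(a, b)\<in>parcs G. f a b * (if a = v then 1 else 0)) = (\<Sum>b | (v, b) \<in> parcs G. f v b)"
proof -
  have "(\<Sum>(a, b)\<in>parcs G. f a b * (if a = v then 1 else 0))
      = (\<Sum>p\<in>Pair v ` {b. (v, b) \<in> parcs G}. f (fst p) (snd p))"
    using assms by (intro sum.mono_neutral_cong_right) (auto split: if_splits)
  also have "\<dots> = (\<Sum>b | (v, b) \<in> parcs G. f v b)"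
    by (subst sum.reindex) (auto simp: inj_on_def)
  finally show ?thesis .
qed

lemma sum_arcs_swap:
  fixes f :: "'a \<Rightarrow> 'a \<Rightarrow> real"
  assumes "pair_graph G"
  shows "(\<Sum>(a, b)\<in>parcs G. f a b) = (\<Sum>(a, b)\<in>parcs G. f b a)"
proof -
  interpret pair_graph G by fact
  have "prod.swap ` parcs G = parcs G"
    using arcs_symmetric by (auto simp: image_iff) (metis swap_simp)
  then have "(\<Sum>p\<in>parcs G. f (fst p) (snd p)) = (\<Sum>p\<in>prod.swap ` parcs G. f (fst p) (snd p))"
    by simp
  also have "\<dots> = (\<Sum>p\<in>parcs G. f (snd p) (fst p))"
    by (subst sum.reindex) auto
  finally show ?thesis by (simp add: case_prod_unfold)
qed

lemma linear_dominates_quadratic_imp_zero: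
  fixes b c :: real
  assumes "\<And>t. 0 \<le> t * b + t\<^sup>2 * c"
  shows "b = 0"
proof (rule ccontr)
  assume "b \<noteq> 0"
  \<comment> \<open>A \<open>t\<close> of sign opposite to \<open>b\<close>, small enough for the
    linear term to win over the quadratic one.\<close>
  define t where "t = - b / (\<bar>c\<bar> + 1)"
  have "t * b + t\<^sup>2 * c \<le> t * b + t\<^sup>2 * \<bar>c\<bar>"
    by (intro add_left_mono mult_left_mono) auto
  also have "\<dots> = - (b\<^sup>2 / (\<bar>c\<bar> + 1)\<^sup>2)"
    unfolding t_def by (simp add: power2_eq_square divide_simps) (simp add: algebra_simps)
  also have "\<dots> < 0" using \<open>b \<noteq> 0\<close> by (simp add: zero_less_divide_iff add_nonneg_eq_0_iff)
  finally show False using assms[of t] by simp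
qed

text \<open>First variation in the direction of the indicator \<open>e\<close> of \<open>v\<close>:
  the coefficient of \<open>t\<close> in the energy minus \<open>q\<close> times the norm must
  vanish. The sum in the conclusion is the entry at \<open>v\<close> of the signless Laplacian
  applied to \<open>x\<close>.\<close>

lemma minimizer_eigen_equation:
  assumes G: "pair_graph G" and v: "v \<in> pverts G"
    and le: "\<And>y. q * sqnorm G y \<le> qform G y" and eq: "qform G x = q * sqnorm G x"
  shows "(\<Sum>u | (v, u) \<in> parcs G. x v + x u) = q * x v"
proof -
  interpret pair_graph G by fact
  define e where "e = (\<lambda>u. if u = v then 1 else 0 :: real)"
  define B where "B = (\<Sum>(a, b)\<in>parcs G. (x a + x b) * (e a + e b))"
  have Q: "qform G (\<lambda>u. x u + t * e u) = qform G x + t * B + t\<^sup>2 * qform G e" for t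
  proof -
    have "(x a + t * e a + (x b + t * e b))\<^sup>2
        = (x a + x b)\<^sup>2 + 2 * t * ((x a + x b) * (e a + e b)) + t\<^sup>2 * (e a + e b)\<^sup>2" for a b
      by (simp add: power2_eq_square algebra_simps)
    then show ?thesis
      unfolding qform_def B_def case_prod_unfold
      by (simp add: sum.distrib add_divide_distrib flip: sum_distrib_left)
  qed
  have N: "sqnorm G (\<lambda>u. x u + t * e u) = sqnorm G x + 2 * t * x v + t\<^sup>2" for t
  proof -
    have "(x u + t * e u)\<^sup>2 = (x u)\<^sup>2 + (if u = v then 2 * t * x v + t\<^sup>2 else 0)" for u
      by (auto simp: e_def power2_eq_square algebra_simps)
    then show ?thesis
      unfolding sqnorm_def using v by (simp add: sum.distrib pair_finite_verts)
  qed
  have nonneg: "0 \<le> t * (B - 2 * q * x v) + t\<^sup>2 * (qform G e - q)" for t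
    using le[of "\<lambda>u. x u + t * e u"] unfolding Q N eq by (simp add: algebra_simps)
  then have B: "B = 2 * q * x v"
    using linear_dominates_quadratic_imp_zero[OF nonneg] by simp
  have "B = (\<Sum>(a, b)\<in>parcs G. (x a + x b) * e a) + (\<Sum>(a, b)\<in>parcs G. (x a + x b) * e b)"
    unfolding B_def case_prod_unfold sum.distrib[symmetric]
    by (intro sum.cong refl) (simp add: algebra_simps)
  also have "(\<Sum>(a, b)\<in>parcs G. (x a + x b) * e b) = (\<Sum>(a, b)\<in>parcs G. (x a + x b) * e a)"
    using sum_arcs_swap[OF G, of "\<lambda>a b. (x a + x b) * e b"] by (simp add: add.commute)
  also have "(\<Sum>(a, b)\<in>parcs G. (x a + x b) * e a) = (\<Sum>u | (v, u) \<in> parcs G. x v + x u)"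
    unfolding e_def using sum_arcs_indicator[of G "\<lambda>a b. x a + x b" v] pair_finite_arcs by simp
  finally show ?thesis using B by linarith
qed

text \<open>The equation at each \<open>v\<close> is multiplied by \<open>x v\<close> and summed;
  the symmetry of the arcs turns the left side into the energy.\<close>

lemma eigen_equation_imp_qform:
  assumes G: "pair_graph G"
    and eq: "\<And>v. v \<in> pverts G \<Longrightarrow> (\<Sum>u | (v, u) \<in> parcs G. x v + x u) = q * x v"
  shows "qform G x = q * sqnorm G x"
proof -
  interpret pair_graph G by fact
  have "(\<Sum>(a, b)\<in>parcs G. (x a + x b)\<^sup>2)
      = (\<Sum>(a, b)\<in>parcs G. x a * (x a + x b)) + (\<Sum>(a, b)\<in>parcs G. x b * (x a + x b))"
    unfolding case_prod_unfold sum.distrib[symmetric]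
    by (intro sum.cong refl) (simp add: power2_eq_square algebra_simps)
  also have "(\<Sum>(a, b)\<in>parcs G. x b * (x a + x b)) = (\<Sum>(a, b)\<in>parcs G. x a * (x a + x b))"
    using sum_arcs_swap[OF G, of "\<lambda>a b. x b * (x a + x b)"] by (simp add: add.commute)
  also have "(\<Sum>(a, b)\<in>parcs G. x a * (x a + x b))
      = (\<Sum>v\<in>pverts G. \<Sum>u | (v, u) \<in> parcs G. x v * (x v + x u))"
  proof -
    have "parcs G = Sigma (pverts G) (\<lambda>v. {u. (v, u) \<in> parcs G})"
      by (auto dest: in_arcsD1)
    moreover have "finite {u. (v, u) \<in> parcs G}" for v
      by (rule finite_subset[OF _ pair_finite_verts]) (auto dest: in_arcsD2)
    ultimately show ?thesis
      by (subst sum.Sigma) (auto simp: pair_finite_verts)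
  qed
  also have "\<dots> = (\<Sum>v\<in>pverts G. x v * (q * x v))"
    using eq by (simp flip: sum_distrib_left)
  finally show ?thesis
    unfolding qform_def sqnorm_def by (simp add: sum_distrib_left power2_eq_square algebra_simps)
qed

text \<open>Transfers eigenvectors from coordinates to functions on the vertices, along the
  enumeration \<open>vs\<close> chosen in the definition of the matrix. The degree counts the
  summands \<open>x v\<close>, which merges the diagonal entry into the sum over the
  neighbours.\<close>

lemma eigenvalue_signless_laplacian_iff:
  assumes G: "pair_graph G"
  shows "eigenvalue (signless_laplacian G) q \<longleftrightarrow>
    (\<exists>x. (\<exists>v\<in>pverts G. x v \<noteq> 0) \<and>
      (\<forall>v\<in>pverts G. (\<Sum>u | (v, u) \<in> parcs G. x v + x u) = q * x v))"
proof -
  interpret pair_graph G by fact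
  define vs where "vs = vertex_list G"
  define n where "n = card (pverts G)"
  have vs: "distinct vs" "set vs = pverts G"
    using someI_ex[of "\<lambda>vs. distinct vs \<and> set vs = pverts G"] finite_distinct_list[OF pair_finite_verts]
    unfolding vs_def vertex_list_def by auto
  have len: "length vs = n" using vs distinct_card n_def by metis
  have bij: "bij_betw ((!) vs) {0..<n} (pverts G)"
    using bij_betw_nth[OF vs(1)] len vs(2) by (simp add: atLeast0LessThan)
  have fin: "finite {u. (v, u) \<in> parcs G}" for v
    by (rule finite_subset[OF _ pair_finite_verts]) (auto dest: in_arcsD2)
  have deg: "out_degree G v = card {u. (v, u) \<in> parcs G}" for v
  proof -
    have "out_arcs G v = Pair v ` {u. (v, u) \<in> parcs G}"
      by (auto simp: out_arcs_def)
    then show ?thesis unfolding out_degree_def by (simp add: card_image inj_on_def)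
  qed
  have dim: "signless_laplacian G \<in> carrier_mat n n"
    unfolding signless_laplacian_def degree_matrix_def adjacency_matrix_def Let_def n_def by simp
  have entry: "(signless_laplacian G *\<^sub>v vec n (\<lambda>i. x (vs ! i))) $ i
      = (\<Sum>u | (vs ! i, u) \<in> parcs G. x (vs ! i) + x u)" if i: "i < n" for i x
  proof -
    let ?v = "vs ! i"
    have "(signless_laplacian G *\<^sub>v vec n (\<lambda>i. x (vs ! i))) $ i
       = (\<Sum>j = 0..<n. ((if i = j then real (out_degree G ?v) else 0)
            + (if (?v, vs ! j) \<in> parcs G then 1 else 0)) * x (vs ! j))"
      using i dim
      by (auto simp: scalar_prod_def signless_laplacian_def degree_matrix_def adjacency_matrix_def
        Let_def vs_def n_def intro!: sum.cong)
    also have "\<dots> = (\<Sum>j = 0..<n. if i = j then real (out_degree G ?v) * x ?v else 0)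
        + (\<Sum>j = 0..<n. if (?v, vs ! j) \<in> parcs G then x (vs ! j) else 0)"
      unfolding sum.distrib[symmetric] by (intro sum.cong) (auto simp: algebra_simps)
    also have "(\<Sum>j = 0..<n. if (?v, vs ! j) \<in> parcs G then x (vs ! j) else 0)
        = (\<Sum>u\<in>pverts G. if (?v, u) \<in> parcs G then x u else 0)"
      using sum.reindex_bij_betw[OF bij] by fastforce
    also have "\<dots> = (\<Sum>u | (?v, u) \<in> parcs G. x u)"
      using pair_finite_verts by (intro sum.mono_neutral_cong_right) (auto dest: in_arcsD2)
    finally show ?thesis using i by (simp add: sum.distrib deg)
  qed
  have coord: "signless_laplacian G *\<^sub>v w = q \<cdot>\<^sub>v w \<longleftrightarrow>
      (\<forall>i<n. (signless_laplacian G *\<^sub>v w) $ i = q * w $ i)" if "w \<in> carrier_vec n" for w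
  proof
    assume "\<forall>i<n. (signless_laplacian G *\<^sub>v w) $ i = q * w $ i"
    then show "signless_laplacian G *\<^sub>v w = q \<cdot>\<^sub>v w" using that dim by (intro eq_vecI) auto
  qed (use that in auto)
  have "eigenvalue (signless_laplacian G) q \<longleftrightarrow> (\<exists>w\<in>carrier_vec n. w \<noteq> 0\<^sub>v n \<and>
      (\<forall>i<n. (signless_laplacian G *\<^sub>v w) $ i = q * w $ i))"
    unfolding eigenvalue_def eigenvector_def carrier_matD(1)[OF dim] using coord by blast
  also have "\<dots> \<longleftrightarrow> (\<exists>x. vec n (\<lambda>i. x (vs ! i)) \<noteq> 0\<^sub>v n \<and>
      (\<forall>i<n. (signless_laplacian G *\<^sub>v vec n (\<lambda>i. x (vs ! i))) $ i = q * x (vs ! i)))"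
    (is "?L \<longleftrightarrow> ?R")
  proof
    assume ?L
    then obtain w where w: "w \<in> carrier_vec n" "w \<noteq> 0\<^sub>v n"
      "\<And>i. i < n \<Longrightarrow> (signless_laplacian G *\<^sub>v w) $ i = q * w $ i" by blast
    define x where "x = (\<lambda>v. w $ (the_inv_into {0..<n} ((!) vs) v))"
    have xi: "x (vs ! i) = w $ i" if "i < n" for i
      unfolding x_def using bij that by (subst the_inv_into_f_f) (auto simp: bij_betw_def)
    then have "vec n (\<lambda>i. x (vs ! i)) = w" using w(1) by auto
    then show ?R using w xi by (intro exI[of _ x]) auto
  next
    assume ?R
    then show ?L by (auto intro!: bexI[of _ "vec n _"])
  qed
  also have "\<dots> \<longleftrightarrow> (\<exists>x. (\<exists>i<n. x (vs ! i) \<noteq> 0) \<and>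
      (\<forall>i<n. (\<Sum>u | (vs ! i, u) \<in> parcs G. x (vs ! i) + x u) = q * x (vs ! i)))"
    by (intro ex_cong1 conj_cong) (use entry in \<open>auto simp: vec_eq_iff\<close>)
  also have "\<dots> \<longleftrightarrow> (\<exists>x. (\<exists>v\<in>pverts G. x v \<noteq> 0) \<and>
      (\<forall>v\<in>pverts G. (\<Sum>u | (v, u) \<in> parcs G. x v + x u) = q * x v))"
    unfolding vs(2)[symmetric] len[symmetric] by (simp add: all_set_conv_all_nth set_conv_nth) blast
  finally show ?thesis .
qed

text \<open>A vector of minimal Rayleigh quotient is an eigenvector. Conversely an eigenvector for
  an eigenvalue \<open>r\<close> has Rayleigh quotient \<open>r\<close>, so no eigenvalue lies below
  \<open>q\<close>.\<close>

lemma q_min_eqI: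
  assumes G: "pair_graph G"
    and le: "\<And>x. q * sqnorm G x \<le> qform G x"
    and x: "sqnorm G x \<noteq> 0" "qform G x = q * sqnorm G x"
  shows "q_min G = q"
proof -
  interpret pair_graph G by fact
  have "eigenvalue (signless_laplacian G) q"
    unfolding eigenvalue_signless_laplacian_iff[OF G]
    using minimizer_eigen_equation[OF G _ le x(2)] x(1) sqnorm_eq_0_iff[OF pair_finite_verts, of x]
    by blast
  moreover have "q \<le> r" if r: "eigenvalue (signless_laplacian G) r" for r
  proof -
    obtain y v where "v \<in> pverts G" "y v \<noteq> 0"
      "\<And>v. v \<in> pverts G \<Longrightarrow> (\<Sum>u | (v, u) \<in> parcs G. y v + y u) = r * y v"
      using r unfolding eigenvalue_signless_laplacian_iff[OF G] by blast
    then have "sqnorm G y > 0" "qform G y = r * sqnorm G y"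
      using sqnorm_pos[OF pair_finite_verts] eigen_equation_imp_qform[OF G] by blast+
    then show ?thesis using le[of y] by simp
  qed
  moreover have "signless_laplacian G \<in> carrier_mat (card (pverts G)) (card (pverts G))"
    unfolding signless_laplacian_def degree_matrix_def adjacency_matrix_def Let_def by simp
  then have "finite (spectrum (signless_laplacian G))"
    by (rule card_finite_spectrum)
  ultimately show ?thesis
    unfolding q_min_def spectrum_def by (intro Min_eqI) auto
qed

lemma q_min_le_qform:
  assumes "pair_graph G" "pverts G \<noteq> {}"
  shows "q_min G * sqnorm G x \<le> qform G x"
  using rayleigh_minimum_exists[OF assms] q_min_eqI[OF assms(1)] by (metis mult.right_neutral zero_neq_one)

lemma q_min_attained:
  assumes "pair_graph G" "pverts G \<noteq> {}"
  obtains x where "sqnorm G x = 1" "qform G x = q_min G"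
  using rayleigh_minimum_exists[OF assms] q_min_eqI[OF assms(1)] that
  by (metis mult.right_neutral zero_neq_one)

lemma q_min_eigen_equation:
  assumes "pair_graph G" "v \<in> pverts G" "qform G x = q_min G * sqnorm G x"
  shows "(\<Sum>u | (v, u) \<in> parcs G. x v + x u) = q_min G * x v"
  using assms q_min_le_qform by (intro minimizer_eigen_equation) auto

section \<open>Odd cycles and closed walks\<close>

lemma awalk_relpow:
  assumes "pair_graph G" "pre_digraph.awalk G u p v"
  shows "(u, v) \<in> parcs G ^^ length p"
proof -
  interpret pair_graph G by fact
  show ?thesis
    using assms(2)
  proof (induction p arbitrary: u)
    case Nil
    then show ?case by (auto simp: awalk_Nil_iff)
  next
    case (Cons e p)
    then show ?case by (cases e) (auto simp: awalk_Cons_iff simp del: relpow.simps intro: relpow_Suc_I2)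
  qed
qed

text \<open>Only the vertices are listed, in cyclic order; rotating a cycle and replacing one of its
  vertices are then plain list operations.\<close>

definition cycle_list :: "('a \<times> 'a) set \<Rightarrow> 'a list \<Rightarrow> bool" where
  "cycle_list E cs \<longleftrightarrow> distinct cs \<and> cs \<noteq> [] \<and>
     (\<forall>i<length cs. (cs ! i, cs ! (Suc i mod length cs)) \<in> E)"

lemma relpow_nth:
  assumes "\<And>i. i < m \<Longrightarrow> (f i, f (Suc i)) \<in> E" "i \<le> j" "j \<le> m"
  shows "(f i, f j) \<in> E ^^ (j - i)"
proof -
  have "i + d \<le> m \<Longrightarrow> (f i, f (i + d)) \<in> E ^^ d" for d
    by (induction d) (use assms(1) in \<open>auto intro: relpow_Suc_I\<close>)
  from this[of "j - i"] assms(2,3) show ?thesis by simp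
qed

text \<open>A repeated vertex would cut the walk into two closed walks whose lengths add up to the
  odd number \<open>m\<close>; one of them would be odd and shorter than \<open>m\<close>.\<close>

lemma shortest_odd_closed_walk:
  assumes "(u, u) \<in> E ^^ m" "odd m"
    and min: "\<And>v l. odd l \<Longrightarrow> (v, v) \<in> E ^^ l \<Longrightarrow> m \<le> l"
  obtains cs where "cycle_list E cs" "length cs = m" "hd cs = u"
proof -
  obtain f where f: "f 0 = u" "f m = u" "\<And>i. i < m \<Longrightarrow> (f i, f (Suc i)) \<in> E"
    using assms(1) unfolding relpow_fun_conv by blast
  have m: "m > 0" using \<open>odd m\<close> by (auto intro: Nat.gr0I)
  have no_repeat: "f i \<noteq> f j" if "i < j" "j < m" for i j
  proof
    assume eq: "f i = f j"
    have "(f i, f i) \<in> E ^^ (j - i)"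
      using relpow_nth[of m f E i j] f(3) that eq by simp
    moreover have "(u, u) \<in> E ^^ (i + (m - j))"
      unfolding relpow_add using relpow_nth[of m f E 0 i] relpow_nth[of m f E j m] f that eq
      by (auto simp: relcomp_unfold)
    ultimately show False
      using min[of "j - i" "f i"] min[of "i + (m - j)" u] that \<open>odd m\<close> by presburger
  qed
  define cs where "cs = map f [0..<m]"
  have "distinct cs"
    unfolding cs_def distinct_map
    by (auto simp: inj_on_def) (metis no_repeat linorder_neqE_nat)
  moreover have "(cs ! i, cs ! (Suc i mod m)) \<in> E" if "i < m" for i
    using f(3)[OF that] that f(1,2) by (cases "Suc i = m") (auto simp: cs_def)
  moreover have "length cs = m" "cs \<noteq> []" "hd cs = u" using m f(1) by (auto simp: cs_def hd_map)
  ultimately show ?thesis using that[of cs] unfolding cycle_list_def by blast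
qed

lemma awalk_verts_map_arcs:
  "pawalk_verts u (map (\<lambda>i. (f i, f (Suc i))) [k..<m]) = (if k < m then map f [k..<Suc m] else [u])"
proof (cases "k < m")
  case True
  then show ?thesis
  proof (induction "m - k" arbitrary: k u)
    case (Suc d)
    show ?case
    proof (cases "Suc k < m")
      case True
      then show ?thesis using Suc.hyps(1)[of "Suc k" "f (Suc k)"] Suc(2,3)
        by (simp add: upt_conv_Cons)
    next
      case False
      then have "m = Suc k" using Suc(3) by simp
      then show ?thesis by simp
    qed
  qed simp
qed simp

lemma cycle_list_imp_cycle:
  assumes "pair_graph G" "cycle_list (parcs G) cs"
  shows "\<exists>p. pre_digraph.cycle G p \<and> length p = length cs"
proof -
  interpret pair_graph G by fact
  define m where "m = length cs"
  \<comment> \<open>Periodic extension, so that the closing arc has the same form as the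
    others.\<close>
  define f where "f i = cs ! (i mod m)" for i
  have m: "m > 0" using assms(2) unfolding cycle_list_def m_def by auto
  have arcs: "(f i, f (Suc i)) \<in> parcs G" for i
    using assms(2) m unfolding cycle_list_def f_def m_def[symmetric] by (metis mod_Suc_eq mod_less_divisor)
  define p where "p = map (\<lambda>i. (f i, f (Suc i))) [0..<m]"
  have vp: "pawalk_verts (f 0) p = map f [0..<Suc m]"
    unfolding p_def awalk_verts_map_arcs using m by simp
  have "awalk (f k) (map (\<lambda>i. (f i, f (Suc i))) [k..<m]) (f m)" if "k \<le> m" for k
    using that
  proof (induction "m - k" arbitrary: k)
    case 0
    then show ?case using arcs in_arcsD1 by (auto simp: awalk_Nil_iff)
  next
    case (Suc d)
    then show ?case using arcs by (auto simp: upt_conv_Cons awalk_Cons_iff)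
  qed
  from this[of 0] have "awalk (f 0) p (f 0)"
    unfolding p_def f_def by simp
  moreover have "tl (pawalk_verts (f 0) p) = map f [1..<Suc m]"
    unfolding vp by (simp add: map_tl[symmetric] del: upt_Suc)
  moreover have "distinct (map f [1..<Suc m])"
  proof -
    have d: "distinct cs" using assms(2) unfolding cycle_list_def by simp
    have "f i \<noteq> f j" if "1 \<le> i" "i < j" "j \<le> m" for i j
    proof (cases "j = m")
      case True
      then show ?thesis using that d m by (auto simp: f_def nth_eq_iff_index_eq m_def)
    next
      case False
      then show ?thesis using that d m by (auto simp: f_def nth_eq_iff_index_eq m_def)
    qed
    then show ?thesis unfolding distinct_map
      by (auto simp: inj_on_def simp del: upt_Suc) (metis linorder_neqE_nat less_Suc_eq_le One_nat_def)
  qed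
  ultimately have "cycle p" unfolding cycle_def using m
    by (intro exI[of _ "f 0"]) (auto simp: p_def)
  then show ?thesis by (intro exI[of _ p]) (simp add: p_def m_def)
qed

text \<open>Closed walks are easier to produce and to cut than cycles, and a shortest odd one is a
  cycle.\<close>

lemma odd_girth_eq_Least_closed_walk:
  assumes G: "pair_graph G"
  shows "odd_girth G = (LEAST m. odd m \<and> (\<exists>u. (u, u) \<in> parcs G ^^ m))"
proof -
  interpret pair_graph G by fact
  let ?P = "\<lambda>m. odd m \<and> (\<exists>p. pre_digraph.cycle G p \<and> length p = m)"
  let ?Q = "\<lambda>m. odd m \<and> (\<exists>u. (u, u) \<in> parcs G ^^ m)"
  have PQ: "?Q m" if "?P m" for m
    using that awalk_relpow[OF G] unfolding cycle_def by blast
  show ?thesis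
  proof (cases "\<exists>m. ?Q m")
    case False
    \<comment> \<open>Without odd closed walks both minima are taken over the same empty predicate,
      so even their unspecified values agree.\<close>
    then have "?P = ?Q" using PQ by blast
    then show ?thesis unfolding odd_girth_def by simp
  next
    case True
    then have "?Q (LEAST m. ?Q m)" by (rule LeastI_ex)
    moreover have le: "(LEAST m. ?Q m) \<le> l" if "?Q l" for l by (rule Least_le[of ?Q, OF that])
    ultimately obtain u where u: "odd (LEAST m. ?Q m)" "(u, u) \<in> parcs G ^^ (LEAST m. ?Q m)" by blast
    obtain cs where "cycle_list (parcs G) cs" "length cs = (LEAST m. ?Q m)"
      using shortest_odd_closed_walk[OF u(2,1)] le by blast
    then have "?P (LEAST m. ?Q m)" using cycle_list_imp_cycle[OF G] u(1) by metis
    then show ?thesis unfolding odd_girth_def using PQ le by (intro Least_equality) auto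
  qed
qed

lemma odd_girth_le:
  assumes "pair_graph G" "(u, u) \<in> parcs G ^^ m" "odd m"
  shows "odd_girth G \<le> m"
  unfolding odd_girth_eq_Least_closed_walk[OF assms(1)] using assms by (intro Least_le) auto

lemma odd_girth_cycle_list:
  assumes "pair_graph G" "(u, u) \<in> parcs G ^^ m" "odd m"
  obtains cs where "cycle_list (parcs G) cs" "length cs = odd_girth G" "odd (odd_girth G)"
proof -
  let ?Q = "\<lambda>m. odd m \<and> (\<exists>u. (u, u) \<in> parcs G ^^ m)"
  have "?Q (odd_girth G)"
    unfolding odd_girth_eq_Least_closed_walk[OF assms(1)] using assms by (intro LeastI_ex[of ?Q]) auto
  then show ?thesis
    using shortest_odd_closed_walk[of _ "odd_girth G" "parcs G"] odd_girth_le[OF assms(1)] that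
    by (metis (no_types, lifting))
qed

section \<open>Connectedness and bipartiteness in terms of walks\<close>

lemma connected_rtrancl:
  assumes "pair_graph G" "Digraph_Component.connected G" "u \<in> pverts G" "v \<in> pverts G"
  shows "(u, v) \<in> (parcs G)\<^sup>*"
proof -
  interpret pair_graph G by fact
  have "strongly_connected G"
    using symmetric_connected_imp_strongly_connected[OF pair_sym_arcs assms(2)] .
  then show ?thesis
    using assms(3,4) reachable_rtranclI[of G u v] by (auto simp: strongly_connected_def)
qed

lemma connectedI_rtrancl:
  assumes "pair_graph G" "r \<in> pverts G" "\<And>v. v \<in> pverts G \<Longrightarrow> (v, r) \<in> (parcs G)\<^sup>*"
  shows "Digraph_Component.connected G"
proof -
  interpret pair_graph G by fact
  have sym: "sym (parcs G)" using arcs_symmetric by (auto intro: symI)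
  have "(u, v) \<in> (parcs G)\<^sup>*" if "u \<in> pverts G" "v \<in> pverts G" for u v
    using assms(3)[OF that(1)] assms(3)[OF that(2)] sym_rtrancl[OF sym] 
    by (meson rtrancl_trans symD)
  moreover have "(u, v) \<in> rtrancl_on (pverts G) ((parcs G)\<^sup>s)"
    if "(u, v) \<in> (parcs G)\<^sup>*" "u \<in> pverts G" for u v
    using that
  proof (induction rule: rtrancl_induct)
    case (step y z)
    then show ?case
      by (auto simp: symcl_def intro: rtrancl_on.rtrancl_on_into_rtrancl_on in_arcsD2)
  qed (simp add: rtrancl_on.rtrancl_on_refl)
  ultimately show ?thesis
    using assms(2) by (auto simp: connected_conv)
qed

text \<open>Vertices are classified by the parity of walks from a root \<open>r\<close>. Every arc
  switches the classes, so without a bipartition some vertex is reached in both parities; going out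
  along one walk and back along the other closes up.\<close>

lemma not_bipartite_odd_closed_walk:
  assumes G: "pair_graph G" and con: "Digraph_Component.connected G" and nb: "\<not> bipartite G"
  obtains u m where "(u, u) \<in> parcs G ^^ m" "odd m"
proof -
  interpret pair_graph G by fact
  have "pverts G \<noteq> {}" using con by (auto simp: connected_conv)
  then obtain r where r: "r \<in> pverts G" by blast
  have sym: "(v, u) \<in> parcs G ^^ m" if "(u, v) \<in> parcs G ^^ m" for u v m
    using that
  proof (induction m arbitrary: u v)
    case (Suc m)
    then obtain w where "(u, w) \<in> parcs G ^^ m" "(w, v) \<in> parcs G" by auto
    then show ?case using Suc.IH arcs_symmetric by (blast intro: relpow_Suc_I2)
  qed simp
  define A where "A = {v \<in> pverts G. \<exists>m. even m \<and> (r, v) \<in> parcs G ^^ m}"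
  define B where "B = {v \<in> pverts G. \<exists>m. odd m \<and> (r, v) \<in> parcs G ^^ m}"
  have "\<exists>m. (r, v) \<in> parcs G ^^ m" if "v \<in> pverts G" for v
    using connected_rtrancl[OF G con r that] by (simp add: rtrancl_power)
  then have "A \<union> B = pverts G" unfolding A_def B_def by blast
  moreover have "(u, v) \<in> A \<times> B \<union> B \<times> A" if uv: "(u, v) \<in> parcs G" for u v
  proof -
    have "u \<in> A \<union> B" using \<open>A \<union> B = pverts G\<close> uv in_arcsD1 by blast
    moreover have "v \<in> B" if "u \<in> A"
      using that uv in_arcsD2 unfolding A_def B_def
      by simp (meson even_Suc relpow_Suc_I)
    moreover have "v \<in> A" if "u \<in> B"
      using that uv in_arcsD2 unfolding A_def B_def
      by simp (meson even_Suc relpow_Suc_I)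
    ultimately show ?thesis by blast
  qed
  ultimately have "A \<inter> B \<noteq> {}" using nb unfolding bipartite_def by (metis subrelI)
  then obtain v k l where "even k" "(r, v) \<in> parcs G ^^ k" "odd l" "(r, v) \<in> parcs G ^^ l"
    unfolding A_def B_def by blast
  then have "(r, r) \<in> parcs G ^^ (k + l)" "odd (k + l)"
    unfolding relpow_add using sym by auto
  then show ?thesis by (rule that)
qed

text \<open>Membership in one side of a bipartition alternates along a walk.\<close>

lemma odd_closed_walk_not_bipartite:
  assumes G: "pair_graph G" and w: "(u, u) \<in> parcs G ^^ m" "odd m"
  shows "\<not> bipartite G"
proof
  assume "bipartite G"
  then obtain A B where AB: "A \<inter> B = {}" "parcs G \<subseteq> A \<times> B \<union> B \<times> A"
    unfolding bipartite_def by blast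
  have "(u \<in> A \<longleftrightarrow> v \<in> A) = even k" if "(u, v) \<in> parcs G ^^ k" for u v k
    using that
  proof (induction k arbitrary: v)
    case (Suc k)
    then obtain y where "(u, y) \<in> parcs G ^^ k" "(y, v) \<in> parcs G" by auto
    then show ?case using Suc.IH[of y] AB by auto
  qed simp
  then show False using w by blast
qed

section \<open>The graphs \<open>U n k g\<close>\<close>

lemma dominating_set_pverts: "dominating_set G (pverts G)"
  by (auto simp: dominating_set_def)

lemma domination_number_le:
  assumes "finite (pverts G)" "dominating_set G S"
  shows "domination_number G \<le> card S"
proof -
  have "{S. dominating_set G S} \<subseteq> Pow (pverts G)" by (auto simp: dominating_set_def)
  then have "finite {S. dominating_set G S}" using assms(1) finite_subset by blast
  then show ?thesis unfolding domination_number_def using assms(2) by (intro Min_le) auto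
qed

lemma domination_number_attained:
  assumes "finite (pverts G)"
  obtains S where "dominating_set G S" "card S = domination_number G"
proof -
  have "{S. dominating_set G S} \<subseteq> Pow (pverts G)" by (auto simp: dominating_set_def)
  then have "finite {S. dominating_set G S}" using assms finite_subset by blast
  then have "domination_number G \<in> card ` {S. dominating_set G S}"
    unfolding domination_number_def using dominating_set_pverts[of G] by (intro Min_in) auto
  then show ?thesis using that by auto
qed

text \<open>\<open>L\<close> is the number of vertices on cycle and path together: the path is
  attached to the cycle at \<open>g - 1\<close>, the star centre is \<open>L - 1\<close>, and the
  leaves are \<open>L, ..., n - 1\<close>.\<close>

locale lollipop_star =
  fixes n k g L :: nat
  assumes odd_g: "odd g" and g3: "3 \<le> g" and k1: "1 \<le> k" and kn: "k \<le> n - g" and gn: "g < n"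
    and L_def: "L = n - k"
begin

lemma gL: "g \<le> L" and Ln: "L < n" and nL: "n = L + k"
  using k1 kn gn unfolding L_def by auto

text \<open>One orientation of every edge. The cycle without its closing edge and the joining path
  merge into a single path \<open>0, ..., L - 1\<close>.\<close>

definition edges :: "(nat \<times> nat) set" where
  "edges = {(i, Suc i) | i. Suc i < L} \<union> {(g - 1, 0)} \<union> {(L - 1, j) | j. L \<le> j \<and> j < n}"

lemma pverts_U [simp]: "pverts (U n k g) = {0..<n}"
  by (simp add: U_def Let_def)

lemma parcs_U: "parcs (U n k g) = edges \<union> edges\<inverse>"
proof -
  have "n - k = L" using L_def by simp
  moreover have "{(i, i + 1) |i. i < g - 1} \<union> {(g - 1, 0)} \<union> {(i, i + 1) |i. g - 1 \<le> i \<and> i < L - 1}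
      = {(i, Suc i) | i. Suc i < L} \<union> {(g - 1, 0)}"
    using gL g3 by (auto simp: less_diff_conv)
  ultimately show ?thesis
    by (simp add: U_def Let_def edges_def)
qed

lemma U_arc_iff: "(i, j) \<in> parcs (U n k g) \<longleftrightarrow>
    (j = Suc i \<and> j < L) \<or> (i = Suc j \<and> i < L) \<or> (i = g - 1 \<and> j = 0) \<or> (i = 0 \<and> j = g - 1) \<or>
    (i = L - 1 \<and> L \<le> j \<and> j < n) \<or> (j = L - 1 \<and> L \<le> i \<and> i < n)"
  unfolding parcs_U edges_def by auto

lemma finite_edges: "finite edges"
proof (rule finite_subset)
  show "edges \<subseteq> {0..<n} \<times> {0..<n}"
    using gL Ln g3 by (auto simp: edges_def)
qed simp

lemma pair_graph_U: "pair_graph (U n k g)"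
proof
  fix e assume "e \<in> parcs (U n k g)"
  then show "fst e \<in> pverts (U n k g)" "snd e \<in> pverts (U n k g)" "fst e \<noteq> snd e"
    using gL Ln g3 by (cases e; auto simp: U_arc_iff)+
next
  show "finite (parcs (U n k g))"
    unfolding parcs_U using finite_edges by simp
next
  show "symmetric (U n k g)"
    unfolding symmetric_def by (auto simp: parcs_U intro: symI)
qed simp

lemma qform_U: "qform (U n k g) x =
    (\<Sum>i<L - 1. (x i + x (Suc i))\<^sup>2) + (x (g - 1) + x 0)\<^sup>2 + (\<Sum>j = L..<n. (x (L - 1) + x j)\<^sup>2)"
proof -
  let ?f = "\<lambda>p. (x (fst p) + x (snd p))\<^sup>2"
  have disj: "edges \<inter> edges\<inverse> = {}"
    using gL Ln g3 by (auto simp: edges_def)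
  have "sum ?f (edges\<inverse>) = sum ?f edges"
    by (rule sum.reindex_bij_witness[of _ prod.swap prod.swap]) (auto simp: add.commute)
  then have "qform (U n k g) x = sum ?f edges"
    unfolding qform_def parcs_U case_prod_unfold using finite_edges disj by (simp add: sum.union_disjoint)
  also have "edges = (\<lambda>i. (i, Suc i)) ` {..<L - 1} \<union> {(g - 1, 0)} \<union> Pair (L - 1) ` {L..<n}"
    by (auto simp: edges_def)
  also have "sum ?f \<dots> = sum ?f ((\<lambda>i. (i, Suc i)) ` {..<L - 1}) + sum ?f {(g - 1, 0)}
      + sum ?f (Pair (L - 1) ` {L..<n})"
    using gL g3 by (subst sum.union_disjoint; (subst sum.union_disjoint)?) auto
  also have "\<dots> = (\<Sum>i<L - 1. (x i + x (Suc i))\<^sup>2) + (x (g - 1) + x 0)\<^sup>2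
      + (\<Sum>j = L..<n. (x (L - 1) + x j)\<^sup>2)"
    by (simp add: sum.reindex inj_on_def)
  finally show ?thesis .
qed

lemma sqnorm_U: "sqnorm (U n k g) x = (\<Sum>i<n. (x i)\<^sup>2)"
  by (simp add: sqnorm_def atLeast0LessThan)

lemma closed_walk_U: "(0, 0) \<in> parcs (U n k g) ^^ g"
proof -
  have "(0, i) \<in> parcs (U n k g) ^^ i" if "i < g" for i
    using that
  proof (induction i)
    case (Suc i)
    then have "(i, Suc i) \<in> parcs (U n k g)" using gL by (auto simp: U_arc_iff)
    then show ?case using Suc by auto
  qed simp
  from this[of "g - 1"] have "(0, g - 1) \<in> parcs (U n k g) ^^ (g - 1)" using g3 by simp
  moreover have "(g - 1, 0) \<in> parcs (U n k g)" by (simp add: U_arc_iff)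
  ultimately have "(0, 0) \<in> parcs (U n k g) ^^ Suc (g - 1)" by auto
  then show ?thesis using g3 by simp
qed

text \<open>
  Deleting the cycle edge between \<open>j - 1\<close> and \<open>j\<close> (between \<open>g - 1\<close> and \<open>0\<close> if \<open>j = 0\<close>) makes
  the graph bipartite, with the following 2-colouring.
\<close>

definition colour :: "nat \<Rightarrow> nat \<Rightarrow> bool" where
  "colour j i \<longleftrightarrow> even (min i L + (if j \<le> i then 1 else 0))"

text \<open>By parity of the index, the only edge with equal colours is the closing edge between
  \<open>g - 1\<close> and \<open>0\<close>, since \<open>g\<close> is odd. Flipping all colours
  from \<open>j\<close> on moves this defect to the edge between \<open>j - 1\<close> and
  \<open>j\<close>. All leaves get the parity of \<open>L\<close>.\<close>

lemma colour_flips: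
  assumes "j < g" "(a, b) \<in> parcs (U n k g)"
    "{a, b} \<noteq> {if j = 0 then g - 1 else j - 1, j}"
  shows "colour j a \<noteq> colour j b"
  using assms gL Ln g3 odd_g unfolding U_arc_iff colour_def
  by (elim disjE conjE) (auto simp: doubleton_eq_iff min_def split: if_splits)

text \<open>An odd closed walk has to use each of the \<open>g\<close> cycle edges, since otherwise
  \<open>colour j\<close> would alternate along it. Different edges are used at different steps, so
  there are at least \<open>g\<close> steps.\<close>

lemma odd_girth_U: "odd_girth (U n k g) = g"
proof (rule antisym)
  show "odd_girth (U n k g) \<le> g"
    using odd_girth_le[OF pair_graph_U closed_walk_U odd_g] .
next
  obtain cs where "cycle_list (parcs (U n k g)) cs" "length cs = odd_girth (U n k g)"
    and odd: "odd (odd_girth (U n k g))"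
    using odd_girth_cycle_list[OF pair_graph_U closed_walk_U odd_g] by blast
  define m where "m = odd_girth (U n k g)"
  define f where "f i = cs ! (i mod m)" for i
  have m: "odd m" "m > 0" using odd unfolding m_def by (auto intro: Nat.gr0I)
  have arcs: "(f i, f (Suc i)) \<in> parcs (U n k g)" for i
    using \<open>cycle_list _ cs\<close> \<open>length cs = _\<close> m unfolding cycle_list_def f_def m_def[symmetric]
    by (metis mod_Suc_eq mod_less_divisor)
  have "\<exists>t<m. {f t, f (Suc t)} = {if j = 0 then g - 1 else j - 1, j}" if "j < g" for j
  proof (rule ccontr)
    assume none: "\<not> ?thesis"
    have "i \<le> m \<Longrightarrow> colour j (f i) = (colour j (f 0) = even i)" for i
    proof (induction i)
      case (Suc i)
      then have "colour j (f i) \<noteq> colour j (f (Suc i))"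
        using none by (intro colour_flips[OF that arcs]) auto
      then show ?case using Suc by auto
    qed simp
    from this[of m] show False using m by (simp add: f_def)
  qed
  then obtain t where t: "\<And>j. j < g \<Longrightarrow> t j < m"
    "\<And>j. j < g \<Longrightarrow> {f (t j), f (Suc (t j))} = {if j = 0 then g - 1 else j - 1, j}" by metis
  have "inj_on t {..<g}"
  proof (rule inj_onI)
    fix a b assume ab: "a \<in> {..<g}" "b \<in> {..<g}" "t a = t b"
    then have "{if a = 0 then g - 1 else a - 1, a} = {if b = 0 then g - 1 else b - 1, b}"
      using t(2)[of a] t(2)[of b] by simp
    then show "a = b" using ab g3 by (auto simp: doubleton_eq_iff split: if_splits)
  qed
  then have "card {..<g} \<le> card {..<m}"
    using t(1) by (intro card_inj_on_le) auto
  then show "g \<le> odd_girth (U n k g)" unfolding m_def by simp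
qed

lemma connected_U: "Digraph_Component.connected (U n k g)"
proof (rule connectedI_rtrancl[OF pair_graph_U, of 0])
  show "0 \<in> pverts (U n k g)" using gn by simp
  have core: "i < L \<Longrightarrow> (i, 0) \<in> (parcs (U n k g))\<^sup>*" for i
  proof (induction i)
    case (Suc i)
    then have "(Suc i, i) \<in> parcs (U n k g)" by (simp add: U_arc_iff)
    then show ?case using Suc by (meson Suc_lessD converse_rtrancl_into_rtrancl)
  qed simp
  fix v assume "v \<in> pverts (U n k g)"
  then have v: "v < n" by simp
  show "(v, 0) \<in> (parcs (U n k g))\<^sup>*"
  proof (cases "v < L")
    case False
    then have "(v, L - 1) \<in> parcs (U n k g)" using v by (simp add: U_arc_iff)
    moreover have "(L - 1, 0) \<in> (parcs (U n k g))\<^sup>*" using core[of "L - 1"] gL g3 by simp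
    ultimately show ?thesis by (rule converse_rtrancl_into_rtrancl)
  qed (rule core)
qed

lemma U_in_nonbipartite_class:
  "U n k g \<in> nonbipartite_class n (domination_number (U n k g)) g"
  unfolding nonbipartite_class_def
  using pair_graph_U connected_U odd_girth_U odd_closed_walk_not_bipartite[OF pair_graph_U closed_walk_U odd_g]
  by simp

end

section \<open>Dependence of the domination number on \<open>k\<close>\<close>

lemma domination_number_U_step:
  assumes "odd g" "3 \<le> g" "g < n" "1 \<le> k" "Suc k \<le> n - g"
  shows "domination_number (U n k g) \<le> Suc (domination_number (U n (Suc k) g))"
proof -
  define L where "L = n - Suc k"
  interpret A: lollipop_star n k g "Suc L"
    using assms unfolding L_def by unfold_locales auto
  interpret B: lollipop_star n "Suc k" g L
    using assms unfolding L_def by unfold_locales auto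
  obtain S where S: "dominating_set (U n (Suc k) g) S" "card S = domination_number (U n (Suc k) g)"
    using domination_number_attained[of "U n (Suc k) g"] by auto
  \<comment> \<open>Position \<open>L\<close> is a leaf for \<open>Suc k\<close> and the star centre
    for \<open>k\<close>. It dominates all leaves of the new graph and also \<open>L - 1\<close>,
    the only vertex that can lose its dominator.\<close>
  have "dominating_set (U n k g) (insert L S)"
    unfolding dominating_set_def
  proof (intro conjI ballI)
    show "insert L S \<subseteq> pverts (U n k g)"
      using S(1) B.Ln by (auto simp: dominating_set_def)
    fix v assume v: "v \<in> pverts (U n k g) - insert L S"
    show "\<exists>u\<in>insert L S. (v, u) \<in> parcs (U n k g)"
    proof (cases "v \<le> L")
      case True
      then have vL: "v < L" using v by auto
      obtain u where u: "u \<in> S" "(v, u) \<in> parcs (U n (Suc k) g)"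
        using S(1) v vL B.Ln unfolding dominating_set_def by fastforce
      show ?thesis
      proof (cases "u < L")
        case True
        then have "(v, u) \<in> parcs (U n k g)"
          using u(2) vL B.gL by (auto simp: A.U_arc_iff B.U_arc_iff)
        then show ?thesis using u by blast
      next
        case False
        then have "v = L - 1" using u(2) vL B.gL by (auto simp: B.U_arc_iff)
        then have "(v, L) \<in> parcs (U n k g)" using B.gL assms(2) by (auto simp: A.U_arc_iff)
        then show ?thesis by blast
      qed
    next
      case False
      then have "(v, L) \<in> parcs (U n k g)" using v by (auto simp: A.U_arc_iff)
      then show ?thesis by blast
    qed
  qed
  then have "domination_number (U n k g) \<le> card (insert L S)"
    by (intro domination_number_le) auto
  also have "\<dots> \<le> Suc (card S)" by (rule card_insert_le_m1) auto
  finally show ?thesis using S(2) by simp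
qed

text \<open>For \<open>k = n - g\<close> the star centre is the cycle vertex \<open>g - 1\<close>,
  which dominates all leaves and the vertices \<open>0\<close> and \<open>g - 2\<close>. The
  positions \<open>3 * j + 2\<close> cover the rest of the cycle in blocks of three.\<close>

lemma domination_number_U_max_star:
  assumes "odd g" "3 \<le> g" "g < n"
  shows "domination_number (U n (n - g) g) \<le> (g + 2) div 3"
proof -
  interpret lollipop_star n "n - g" g g
    using assms by unfold_locales auto
  define r where "r = (g + 2) div 3"
  define S where "S = insert (g - 1) ((\<lambda>j. 3 * j + 2) ` {..<r - 1})"
  have "dominating_set (U n (n - g) g) S"
    unfolding dominating_set_def
  proof (intro conjI ballI)
    show "S \<subseteq> pverts (U n (n - g) g)"
      using assms by (auto simp: S_def r_def)
    fix v assume v: "v \<in> pverts (U n (n - g) g) - S"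
    show "\<exists>u\<in>S. (v, u) \<in> parcs (U n (n - g) g)"
    proof (cases "v = 0 \<or> v \<ge> g - 2")
      case True
      then have "(v, g - 1) \<in> parcs (U n (n - g) g)"
        using v assms by (auto simp: U_arc_iff S_def)
      then show ?thesis by (auto simp: S_def)
    next
      case False
      \<comment> \<open>The block of \<open>v\<close> is
        \<open>3 * j + 1, 3 * j + 2, 3 * j + 3\<close>.\<close>
      define j where "j = (v - 1) div 3"
      have j: "j < r - 1" using False assms(2) unfolding j_def r_def by linarith
      have u: "3 * j + 2 = Suc v \<or> v = 3 * j + 2 \<or> v = Suc (3 * j + 2)"
        using False unfolding j_def by linarith
      have "v \<noteq> 3 * j + 2" using v j by (auto simp: S_def)
      then have "(v, 3 * j + 2) \<in> parcs (U n (n - g) g)"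
        using u False by (auto simp: U_arc_iff)
      then show ?thesis using j by (auto simp: S_def)
    qed
  qed
  then have "domination_number (U n (n - g) g) \<le> card S"
    by (intro domination_number_le) auto
  also have "\<dots> \<le> Suc (card ((\<lambda>j. 3 * j + 2) ` {..<r - 1}))"
    unfolding S_def by (rule card_insert_le_m1) auto
  also have "\<dots> \<le> Suc (r - 1)" using card_image_le[of "{..<r - 1}"] by fastforce
  also have "\<dots> = r" using assms(2) by (simp add: r_def)
  finally show ?thesis unfolding r_def .
qed

text \<open>Discrete intermediate value argument: lowering \<open>k\<close> by one raises the
  domination number by at most one, so no value is skipped on the way down to 1.\<close>

lemma domination_number_U_intermediate:
  assumes "odd g" "3 \<le> g" "g < n" "1 \<le> k" "k \<le> n - g"
    and "domination_number (U n k g) \<le> \<gamma>" "\<gamma> \<le> domination_number (U n 1 g)"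
  shows "\<exists>k'. 1 \<le> k' \<and> k' \<le> k \<and> domination_number (U n k' g) = \<gamma>"
  using assms(4,5,6)
proof (induction k rule: nat_induct_at_least)
  case base
  then show ?case using assms(7) by (intro exI[of _ 1]) auto
next
  case (Suc k)
  show ?case
  proof (cases "domination_number (U n (Suc k) g) = \<gamma>")
    case True
    then show ?thesis using Suc by (intro exI[of _ "Suc k"]) auto
  next
    case False
    then have "domination_number (U n k g) \<le> \<gamma>"
      using domination_number_U_step[of g n k] assms(1-3) Suc by linarith
    then show ?thesis using Suc by (metis Suc_leD le_SucI)
  qed
qed

section \<open>Minimizers on \<open>U n k g\<close>\<close>

lemma qform_bij:
  assumes "inj_on \<phi> (pverts G)" "pair_graph G" "map_prod \<phi> \<phi> ` parcs G = parcs H"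
  shows "qform H x = qform G (x \<circ> \<phi>)"
proof -
  interpret pair_graph G by fact
  have "inj_on (map_prod \<phi> \<phi>) (parcs G)"
    using assms(1) in_arcsD1 in_arcsD2 by (auto simp: inj_on_def)
  then have "(\<Sum>p\<in>map_prod \<phi> \<phi> ` parcs G. (x (fst p) + x (snd p))\<^sup>2)
      = (\<Sum>p\<in>parcs G. (x (\<phi> (fst p)) + x (\<phi> (snd p)))\<^sup>2)"
    by (simp add: sum.reindex)
  then show ?thesis unfolding qform_def case_prod_unfold assms(3) by simp
qed

lemma sqnorm_bij:
  assumes "bij_betw \<phi> (pverts G) (pverts H)"
  shows "sqnorm H x = sqnorm G (x \<circ> \<phi>)"
  unfolding sqnorm_def using sum.reindex_bij_betw[OF assms, of "\<lambda>v. (x v)\<^sup>2"] by simp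

lemma sum_rotate:
  fixes F :: "nat \<Rightarrow> real"
  assumes "c < g"
  shows "(\<Sum>i<g. F ((i + c) mod g)) = (\<Sum>i<g. F i)"
proof (rule sum.reindex_bij_witness[of _ "\<lambda>i. (i + (g - c)) mod g" "\<lambda>i. (i + c) mod g"])
  fix a assume a: "a \<in> {..<g}"
  have "((a + c) mod g + (g - c)) mod g = (a + c + (g - c)) mod g" by (simp add: mod_add_left_eq)
  also have "\<dots> = a" using a assms by simp
  finally show "((a + c) mod g + (g - c)) mod g = a" .
  have "((a + (g - c)) mod g + c) mod g = (a + (g - c) + c) mod g" by (simp add: mod_add_left_eq)
  also have "\<dots> = a" using a assms by simp
  finally show "((a + (g - c)) mod g + c) mod g = a" .
qed (use assms in auto)

context lollipop_star
begin

section \<open>Bounds on the least eigenvalue and the mirror symmetry\<close>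

abbreviation "q \<equiv> q_min (U n k g)"

lemma pverts_U_ne: "pverts (U n k g) \<noteq> {}"
  using gn by simp

lemma q_le: "q * sqnorm (U n k g) x \<le> qform (U n k g) x"
  by (rule q_min_le_qform[OF pair_graph_U pverts_U_ne])

text \<open>With cyclic indices the energy of the cycle is visibly invariant under rotation.\<close>

lemma qform_U_cycle: "qform (U n k g) x = (\<Sum>i<g. (x i + x ((i + 1) mod g))\<^sup>2)
    + (\<Sum>i = g - 1..<L - 1. (x i + x (Suc i))\<^sup>2) + (\<Sum>j = L..<n. (x (L - 1) + x j)\<^sup>2)"
proof -
  obtain h where h: "g = Suc h" using g3 by (cases g) auto
  have "{..<L - 1} = {..<h} \<union> {h..<L - 1}" using gL h by auto
  then have "(\<Sum>i<L - 1. (x i + x (Suc i))\<^sup>2)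
      = (\<Sum>i<h. (x i + x (Suc i))\<^sup>2) + (\<Sum>i = h..<L - 1. (x i + x (Suc i))\<^sup>2)"
    by (simp add: sum.union_disjoint ivl_disj_int)
  moreover have "(\<Sum>i<g. (x i + x ((i + 1) mod g))\<^sup>2)
      = (\<Sum>i<h. (x i + x (Suc i))\<^sup>2) + (x h + x 0)\<^sup>2"
    unfolding h by simp
  ultimately show ?thesis unfolding qform_U using h by simp
qed

lemma sqnorm_U_ge:
  assumes "A \<subseteq> {..<n}"
  shows "(\<Sum>i\<in>A. (x i)\<^sup>2) \<le> sqnorm (U n k g) x"
  unfolding sqnorm_U using assms by (intro sum_mono2) auto

text \<open>Energy zero forces the values to alternate in sign along \<open>0, ..., L - 1\<close>.
  As \<open>g - 1\<close> is even, the closing edge then forces \<open>x 0 = 0\<close>, and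
  everything vanishes.\<close>

lemma q_pos: "0 < q"
proof (rule ccontr)
  assume "\<not> 0 < q"
  obtain x where x: "sqnorm (U n k g) x = 1" "qform (U n k g) x = q"
    using q_min_attained[OF pair_graph_U pverts_U_ne] by blast
  then have "qform (U n k g) x = 0" using \<open>\<not> 0 < q\<close> qform_nonneg[of "U n k g" x] by linarith
  moreover have nn: "0 \<le> (\<Sum>i<L - 1. (x i + x (Suc i))\<^sup>2)" "0 \<le> (x (g - 1) + x 0)\<^sup>2"
    "0 \<le> (\<Sum>j = L..<n. (x (L - 1) + x j)\<^sup>2)"
    by (auto intro: sum_nonneg)
  ultimately have z: "(\<Sum>i<L - 1. (x i + x (Suc i))\<^sup>2) = 0" "(x (g - 1) + x 0)\<^sup>2 = 0"
    "(\<Sum>j = L..<n. (x (L - 1) + x j)\<^sup>2) = 0"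
    using nn unfolding qform_U by linarith+
  have step: "x (Suc i) = - x i" if "i < L - 1" for i
    using z(1) that by (subst (asm) sum_nonneg_eq_0_iff) (auto simp: add_eq_0_iff)
  have core: "i < L \<Longrightarrow> x i = (-1) ^ i * x 0" for i
    by (induction i) (auto simp: step)
  have "x (g - 1) = x 0" using core[of "g - 1"] gL g3 odd_g by (simp add: uminus_power_if)
  then have "x 0 = 0" using z(2) by simp
  then have c0: "x i = 0" if "i < L" for i using core[OF that] by simp
  have "x j = 0" if "j \<in> {L..<n}" for j
    using z(3) that c0[of "L - 1"] gL g3 by (subst (asm) sum_nonneg_eq_0_iff) auto
  then have "x i = 0" if "i < n" for i using c0 that by (cases "i < L") auto
  then have "\<forall>i\<in>pverts (U n k g). x i = 0" by simp
  then have "sqnorm (U n k g) x = 0" by (simp add: sqnorm_def)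
  then show False using x(1) by simp
qed

text \<open>The indicator \<open>e\<close> of a leaf has Rayleigh quotient 1. It is not a minimizer:
  the eigenvector equation fails at the star centre, where \<open>e\<close> vanishes while exactly
  one neighbour has value 1.\<close>

lemma q_less_1: "q < 1"
proof -
  define e where "e i = (if i = n - 1 then 1 else 0 :: real)" for i
  have n1: "L \<le> n - 1" "n - 1 < n" using Ln by auto
  have sq: "(e i)\<^sup>2 = (if i = n - 1 then 1 else 0)" for i by (simp add: e_def)
  have e0: "e i = 0" if "i < L" for i using that n1 by (auto simp: e_def)
  have N: "sqnorm (U n k g) e = 1"
    unfolding sqnorm_U sq using n1 by simp
  have "(\<Sum>i<L - 1. (e i + e (Suc i))\<^sup>2) = 0"
    by (intro sum.neutral) (auto simp: e0)
  then have Q: "qform (U n k g) e = 1"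
    unfolding qform_U using n1 gL g3 by (simp add: e0 sq)
  have "q \<noteq> 1"
  proof
    assume q: "q = 1"
    interpret P: pair_graph "U n k g" by (rule pair_graph_U)
    have "finite {u. (L - 1, u) \<in> parcs (U n k g)}"
      by (rule finite_subset[OF _ P.pair_finite_verts]) (auto dest: P.in_arcsD2)
    moreover have "n - 1 \<in> {u. (L - 1, u) \<in> parcs (U n k g)}"
      using n1 by (auto simp: U_arc_iff)
    ultimately have "(\<Sum>u | (L - 1, u) \<in> parcs (U n k g). e u) = 1"
      unfolding e_def by (subst sum.delta) auto
    moreover have "e (L - 1) = 0" using gL g3 by (intro e0) auto
    moreover have "(\<Sum>u | (L - 1, u) \<in> parcs (U n k g). e (L - 1) + e u) = q * e (L - 1)"
      by (rule q_min_eigen_equation[OF pair_graph_U]) (use N Q q Ln in auto)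
    ultimately show False by simp
  qed
  then show ?thesis using q_le[of e] N Q by simp
qed

text \<open>The automorphism that flips the cycle and fixes the attachment vertex
  \<open>g - 1\<close>, the tail and the leaves.\<close>

definition reflect :: "nat \<Rightarrow> nat" where
  "reflect i = (if i < g - 1 then g - 2 - i else i)"

lemma reflect_reflect: "reflect (reflect i) = i"
  using g3 by (auto simp: reflect_def)

lemma reflect_arc:
  assumes "(a, b) \<in> parcs (U n k g)"
  shows "(reflect a, reflect b) \<in> parcs (U n k g)"
proof -
  interpret P: pair_graph "U n k g" by (rule pair_graph_U)
  have "Suc (Suc (g - 2)) = g" using g3 by simp
  then obtain h where h: "Suc (Suc h) = g" by blast
  have r: "reflect i = (if i \<le> h then h - i else i)" for i
    unfolding reflect_def using h by auto
  have *: "(reflect a, reflect b) \<in> parcs (U n k g)"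
    if "b = Suc a \<and> b < L \<or> a = g - 1 \<and> b = 0 \<or> a = L - 1 \<and> L \<le> b \<and> b < n" for a b
    using that
  proof (elim disjE conjE)
    assume b: "b = Suc a" "b < L"
    consider "b \<le> h" | "a = h" | "h < a" using b by linarith
    then show ?thesis
    proof cases
      case 1
      then have "reflect a = h - a" "reflect b = h - b" "h - a = Suc (h - b)" using b by (auto simp: r)
      moreover have "h - a < L" using gL h by simp
      ultimately show ?thesis unfolding U_arc_iff by simp
    next
      case 2
      then have "reflect a = 0" "reflect b = g - 1" using b h by (auto simp: r)
      then show ?thesis unfolding U_arc_iff by simp
    next
      case 3
      then have "reflect a = a" "reflect b = b" using b by (auto simp: r)
      then show ?thesis unfolding U_arc_iff using b by simp
    qed
  next
    assume "a = g - 1" "b = 0"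
    then have "reflect a = Suc h" "reflect b = h" "Suc h < L" using gL h by (auto simp: r)
    then show ?thesis unfolding U_arc_iff by simp
  next
    assume ab: "a = L - 1" "L \<le> b" "b < n"
    then have "reflect a = a" "reflect b = b" using gL h by (auto simp: r)
    then show ?thesis unfolding U_arc_iff using ab by simp
  qed
  show ?thesis
  proof (cases "b = Suc a \<and> b < L \<or> a = g - 1 \<and> b = 0 \<or> a = L - 1 \<and> L \<le> b \<and> b < n")
    case False
    then have "(reflect b, reflect a) \<in> parcs (U n k g)"
      using assms[unfolded U_arc_iff] by (intro *) blast
    then show ?thesis by (rule P.arcs_symmetric)
  qed (rule *)
qed

lemma reflect_less: "i < n \<Longrightarrow> reflect i < n"
  using gn by (auto simp: reflect_def)

lemma bij_reflect: "bij_betw reflect (pverts (U n k g)) (pverts (U n k g))"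
  by (rule bij_betwI[of _ _ _ reflect]) (auto simp: reflect_reflect reflect_less)

lemma map_prod_reflect: "map_prod reflect reflect ` parcs (U n k g) = parcs (U n k g)"
proof
  show "parcs (U n k g) \<subseteq> map_prod reflect reflect ` parcs (U n k g)"
  proof
    fix p assume p: "p \<in> parcs (U n k g)"
    then have "map_prod reflect reflect p \<in> parcs (U n k g)" by (cases p) (auto intro: reflect_arc)
    moreover have "p = map_prod reflect reflect (map_prod reflect reflect p)"
      by (cases p) (simp add: reflect_reflect)
    ultimately show "p \<in> map_prod reflect reflect ` parcs (U n k g)" by blast
  qed
qed (auto intro: reflect_arc)

text \<open>
  A nonzero antisymmetric minimizer would vanish on the tail. Rotating it around the cycle and
  extending it along the tail with alternating signs keeps the energy and increases the norm.
\<close>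

lemma minimizer_reflect:
  assumes eq: "qform (U n k g) y = q * sqnorm (U n k g) y" and i: "i < g - 1"
  shows "y (g - 2 - i) = y i"
proof (rule ccontr)
  assume ne: "y (g - 2 - i) \<noteq> y i"
  \<comment> \<open>Twice the antisymmetric part of \<open>y\<close>. By the parallelogram law it
    has minimal Rayleigh quotient as well.\<close>
  define u where "u v = y v - y (reflect v)" for v
  have u_eq: "u = (\<lambda>v. y v - (y \<circ> reflect) v)" by (simp add: u_def fun_eq_iff)
  have eq': "qform (U n k g) (y \<circ> reflect) = q * sqnorm (U n k g) (y \<circ> reflect)"
    using eq qform_bij[OF bij_betw_imp_inj_on[OF bij_reflect] pair_graph_U map_prod_reflect, of y]
      sqnorm_bij[OF bij_reflect, of y] by simp
  have Qu: "qform (U n k g) u = q * sqnorm (U n k g) u"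
  proof (rule antisym)
    have "q * sqnorm (U n k g) (\<lambda>v. y v + (y \<circ> reflect) v) \<le> qform (U n k g) (\<lambda>v. y v + (y \<circ> reflect) v)"
      by (rule q_le)
    moreover have "sqnorm (U n k g) u + sqnorm (U n k g) (\<lambda>v. y v + (y \<circ> reflect) v)
        = 2 * sqnorm (U n k g) y + 2 * sqnorm (U n k g) (y \<circ> reflect)"
      unfolding u_eq by (rule sqnorm_parallelogram)
    then have "q * (sqnorm (U n k g) u + sqnorm (U n k g) (\<lambda>v. y v + (y \<circ> reflect) v))
        = q * (2 * sqnorm (U n k g) y + 2 * sqnorm (U n k g) (y \<circ> reflect))" by simp
    then have "q * sqnorm (U n k g) u + q * sqnorm (U n k g) (\<lambda>v. y v + (y \<circ> reflect) v)
        = 2 * (q * sqnorm (U n k g) y) + 2 * (q * sqnorm (U n k g) (y \<circ> reflect))"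
      by (simp only: distrib_left mult.left_commute[of q 2])
    moreover have "qform (U n k g) u + qform (U n k g) (\<lambda>v. y v + (y \<circ> reflect) v)
        = 2 * qform (U n k g) y + 2 * qform (U n k g) (y \<circ> reflect)"
      unfolding u_eq by (rule qform_parallelogram)
    ultimately show "qform (U n k g) u \<le> q * sqnorm (U n k g) u"
      unfolding eq eq' by linarith
  qed (rule q_le)
  have u0: "u v = 0" if "v \<ge> g - 1" for v using that by (simp add: u_def reflect_def)
  define j where "j = i"
  have j: "j < g - 1" "u j \<noteq> 0" using i ne by (auto simp: j_def u_def reflect_def)
  \<comment> \<open>The shift by \<open>Suc j\<close> brings the nonzero value \<open>u j\<close> to
    the attachment vertex \<open>g - 1\<close>. Through \<open>min i L\<close> all leaves get the
    value opposite to that of the star centre.\<close>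
  define v where "v i = (if i < g then u ((i + Suc j) mod g)
    else (-1) ^ (min i L - (g - 1)) * u j)" for i
  have vg: "v (g - 1) = u j" using j g3 by (simp add: v_def)
  have vt: "v i = (-1) ^ (min i L - (g - 1)) * u j" if "g - 1 \<le> i" for i
    using that gL vg by (cases "i = g - 1") (auto simp: v_def)
  have vstep: "v (Suc i) = - v i" if "g - 1 \<le> i" "i < L" for i
    using that by (simp add: vt Suc_diff_le)
  have "(\<Sum>i = g - 1..<L - 1. (v i + v (Suc i))\<^sup>2) = 0"
    by (intro sum.neutral) (auto simp: vstep)
  moreover have "v l = - v (L - 1)" if "L \<le> l" for l
  proof -
    have "v l = v L" using that gL by (simp add: vt)
    then show ?thesis using vstep[of "L - 1"] gL g3 by simp
  qed
  then have "(\<Sum>l = L..<n. (v (L - 1) + v l)\<^sup>2) = 0"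
    by (intro sum.neutral) auto
  moreover have "(\<Sum>i<g. (v i + v ((i + 1) mod g))\<^sup>2)
      = (\<Sum>i<g. (u ((i + Suc j) mod g) + u (((i + Suc j) mod g + 1) mod g))\<^sup>2)"
  proof (intro sum.cong refl)
    fix i assume i: "i \<in> {..<g}"
    have "((i + 1) mod g + Suc j) mod g = (i + 1 + Suc j) mod g" by (rule mod_add_left_eq)
    also have "\<dots> = (i + Suc j + 1) mod g" by (simp add: add.commute)
    also have "\<dots> = ((i + Suc j) mod g + 1) mod g" by (rule mod_add_left_eq[symmetric])
    finally show "(v i + v ((i + 1) mod g))\<^sup>2
        = (u ((i + Suc j) mod g) + u (((i + Suc j) mod g + 1) mod g))\<^sup>2"
      using i g3 by (simp add: v_def)
  qed
  then have "(\<Sum>i<g. (v i + v ((i + 1) mod g))\<^sup>2) = (\<Sum>i<g. (u i + u ((i + 1) mod g))\<^sup>2)"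
    using sum_rotate[of "Suc j" g "\<lambda>i. (u i + u ((i + 1) mod g))\<^sup>2"] j g3 by simp
  ultimately have "qform (U n k g) v = (\<Sum>i<g. (u i + u ((i + 1) mod g))\<^sup>2)"
    unfolding qform_U_cycle by simp
  also have "\<dots> = qform (U n k g) u"
  proof -
    have "(\<Sum>i = g - 1..<L - 1. (u i + u (Suc i))\<^sup>2) = 0"
      by (intro sum.neutral) (auto simp: u0)
    moreover have "(\<Sum>l = L..<n. (u (L - 1) + u l)\<^sup>2) = 0"
      using gL by (intro sum.neutral) (auto simp: u0)
    ultimately show ?thesis unfolding qform_U_cycle by simp
  qed
  finally have Qv: "qform (U n k g) v = q * sqnorm (U n k g) u" using Qu by simp
  have "sqnorm (U n k g) u = (\<Sum>i<g. (u i)\<^sup>2)"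
    unfolding sqnorm_U using gn u0 by (intro sum.mono_neutral_right) auto
  also have "\<dots> = (\<Sum>i<g. (u ((i + Suc j) mod g))\<^sup>2)"
    using sum_rotate[of "Suc j" g "\<lambda>i. (u i)\<^sup>2"] j g3 by simp
  also have "\<dots> = (\<Sum>i<g. (v i)\<^sup>2)" by (simp add: v_def)
  \<comment> \<open>A single leaf already adds \<open>(u j)\<^sup>2\<close> to the norm on the
    cycle.\<close>
  finally have "sqnorm (U n k g) u + (v (n - 1))\<^sup>2 = (\<Sum>i\<in>insert (n - 1) {..<g}. (v i)\<^sup>2)"
    using gL Ln by simp
  also have "\<dots> \<le> sqnorm (U n k g) v" using gn by (intro sqnorm_U_ge) auto
  finally have "sqnorm (U n k g) u + (u j)\<^sup>2 \<le> sqnorm (U n k g) v"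
    using gL Ln by (subst (asm) vt) (auto simp: power_mult_distrib simp flip: power_mult)
  then have "q * (sqnorm (U n k g) u + (u j)\<^sup>2) \<le> q * sqnorm (U n k g) u"
    using q_le[of v] Qv q_pos mult_left_mono[of "sqnorm (U n k g) u + (u j)\<^sup>2" "sqnorm (U n k g) v" q]
    by linarith
  then show False using q_pos j(2) by (simp add: distrib_left mult_le_0_iff)
qed

text \<open>The edge between \<open>m - 1\<close> and \<open>m\<close> is opposite to the attachment
  vertex; \<open>reflect\<close> exchanges its ends.\<close>

definition m :: nat where
  "m = (g - 1) div 2"

lemma m_bounds: "1 \<le> m" "Suc (2 * m) = g"
  using g3 odd_g unfolding m_def by (auto elim!: oddE)

section \<open>Growth of the absolute values of a minimizer towards the leaves\<close>

context
  fixes y :: "nat \<Rightarrow> real"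
  assumes min: "qform (U n k g) y = q * sqnorm (U n k g) y"
    and pos: "0 < sqnorm (U n k g) y"
begin

definition signed :: "nat \<Rightarrow> real" where
  "signed i = (if colour m i then 1 else -1) * \<bar>y i\<bar>"

lemma mirror: "i < m \<Longrightarrow> y (g - 2 - i) = y i"
  using minimizer_reflect[OF min, of i] m_bounds by simp

text \<open>The only edge with equal signs at its ends is the one opposite to the attachment vertex.\<close>

lemma signed_minimizer: "qform (U n k g) signed = q * sqnorm (U n k g) signed"
proof (rule antisym)
  have "(signed a + signed b)\<^sup>2 \<le> (y a + y b)\<^sup>2" if ab: "(a, b) \<in> parcs (U n k g)" for a b
  proof (cases "{a, b} = {m - 1, m}")
    case True
    \<comment> \<open>With equal values at both ends, no choice of signs on the opposite edge costs
      more than \<open>y\<close> does.\<close>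
    have "y (m - 1) = y m"
    proof -
      have "g - 2 - (m - 1) = m" using m_bounds by linarith
      then show ?thesis using mirror[of "m - 1"] m_bounds by simp
    qed
    then have "y a = y b" using True by (auto simp: doubleton_eq_iff)
    then have "\<bar>signed a + signed b\<bar> \<le> \<bar>y a + y b\<bar>" by (auto simp: signed_def)
    then show ?thesis by (simp add: abs_le_square_iff)
  next
    case False
    then have "colour m a \<noteq> colour m b"
      using colour_flips[OF _ ab, of m] m_bounds by auto
    then have "\<bar>signed a + signed b\<bar> \<le> \<bar>y a + y b\<bar>" by (auto simp: signed_def)
    then show ?thesis by (simp add: abs_le_square_iff)
  qed
  then have "qform (U n k g) signed \<le> qform (U n k g) y"
    unfolding qform_def by (intro divide_right_mono sum_mono) auto
  moreover have "sqnorm (U n k g) signed = sqnorm (U n k g) y"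
    unfolding sqnorm_def by (intro sum.cong) (auto simp: signed_def power2_eq_square)
  ultimately show "qform (U n k g) signed \<le> q * sqnorm (U n k g) signed" using min by simp
qed (rule q_le)

text \<open>Away from the opposite edge all neighbours of \<open>v\<close> have the other colour.
  Multiplying the eigenvector equation of \<open>signed\<close> by the sign of \<open>v\<close>
  turns it into an equation for absolute values.\<close>

lemma abs_flux:
  assumes v: "v < n" "v \<noteq> m" "v \<noteq> m - 1"
  shows "(\<Sum>u | (v, u) \<in> parcs (U n k g). \<bar>y v\<bar> - \<bar>y u\<bar>) = q * \<bar>y v\<bar>"
proof -
  define s where "s = (if colour m v then 1 else -1 :: real)"
  have s: "s * s = 1" by (simp add: s_def)
  have "s * (signed v + signed u) = \<bar>y v\<bar> - \<bar>y u\<bar>" if "(v, u) \<in> parcs (U n k g)" for u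
  proof -
    have "colour m v \<noteq> colour m u"
      using colour_flips[OF _ that, of m] m_bounds v by (auto simp: doubleton_eq_iff)
    then show ?thesis by (auto simp: s_def signed_def)
  qed
  then have "(\<Sum>u | (v, u) \<in> parcs (U n k g). \<bar>y v\<bar> - \<bar>y u\<bar>)
      = s * (\<Sum>u | (v, u) \<in> parcs (U n k g). signed v + signed u)"
    unfolding sum_distrib_left by (intro sum.cong) auto
  also have "\<dots> = s * (q * signed v)"
    using q_min_eigen_equation[OF pair_graph_U _ signed_minimizer, of v] v(1) by simp
  also have "\<dots> = q * \<bar>y v\<bar>" using s by (simp add: signed_def s_def)
  finally show ?thesis .
qed

text \<open>The neighbour \<open>m - 1\<close> has the same sign and, by the mirror symmetry, the
  same value as \<open>m\<close>, so the edge to it contributes \<open>2 * \<bar>y m\<bar>\<close>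
  to the equation at \<open>m\<close>.\<close>

lemma abs_flux_m: "\<bar>y (Suc m)\<bar> = (3 - q) * \<bar>y m\<bar>"
proof -
  have "{u. (m, u) \<in> parcs (U n k g)} = {m - 1, Suc m}"
    using m_bounds gL by (auto simp: U_arc_iff)
  moreover have "(\<Sum>u\<in>{m - 1, Suc m}. signed m + signed u)
      = (signed m + signed (m - 1)) + (signed m + signed (Suc m))"
    by (subst sum.insert) auto
  ultimately have "(signed m + signed (m - 1)) + (signed m + signed (Suc m)) = q * signed m"
    using q_min_eigen_equation[OF pair_graph_U _ signed_minimizer, of m] m_bounds gn by simp
  moreover have "colour m m \<noteq> colour m (Suc m)"
    by (rule colour_flips) (use m_bounds gL in \<open>auto simp: U_arc_iff doubleton_eq_iff\<close>)
  moreover have "colour m m = colour m (m - 1)"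
    using m_bounds gL by (auto simp: colour_def min_def)
  moreover have "y (m - 1) = y m"
  proof -
    have "g - 2 - (m - 1) = m" using m_bounds by linarith
    then show ?thesis using mirror[of "m - 1"] m_bounds by simp
  qed
  ultimately show ?thesis unfolding signed_def by (auto simp: algebra_simps split: if_splits)
qed

lemma leaf_equation:
  assumes "L \<le> j" "j < n"
  shows "(1 - q) * y j = - y (L - 1)"
proof -
  have "{u. (j, u) \<in> parcs (U n k g)} = {L - 1}"
    using assms gL g3 by (auto simp: U_arc_iff)
  then have "y j + y (L - 1) = q * y j"
    using q_min_eigen_equation[OF pair_graph_U _ min, of j] assms by simp
  then show ?thesis by (simp add: algebra_simps)
qed

lemma leaf_diff:
  assumes "L \<le> j" "j < n"
  shows "\<bar>y j\<bar> - \<bar>y (L - 1)\<bar> = q * \<bar>y j\<bar>"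
proof -
  have "(1 - q) * \<bar>y j\<bar> = \<bar>y (L - 1)\<bar>"
    using leaf_equation[OF assms] q_less_1 by (metis abs_minus_cancel abs_mult abs_of_pos diff_gt_0_iff_gt)
  then show ?thesis by (simp add: algebra_simps)
qed

lemma leaves_sum_nonpos: "(\<Sum>j = L..<n. \<bar>y (L - 1)\<bar> - \<bar>y j\<bar>) \<le> 0"
proof (rule sum_nonpos)
  fix j assume "j \<in> {L..<n}"
  moreover have "0 \<le> q * \<bar>y j\<bar>" using q_pos by simp
  ultimately show "\<bar>y (L - 1)\<bar> - \<bar>y j\<bar> \<le> 0" using leaf_diff[of j] by simp
qed

text \<open>Induction from the star centre towards the cycle. At the centre the leaves contribute
  nonpositive terms. At an earlier vertex the increment into it equals the increment out of it plus
  \<open>q\<close> times its absolute value, so the bound is inherited.\<close>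

lemma tail_diff:
  assumes "g - 1 \<le> i" "Suc i < L"
  shows "q * \<bar>y (L - 1)\<bar> \<le> \<bar>y (Suc i)\<bar> - \<bar>y i\<bar>"
  using assms
proof (induction "L - Suc (Suc i)" arbitrary: i)
  case 0
  then have i: "Suc i = L - 1" "i = L - 2" by auto
  have "{u. (L - 1, u) \<in> parcs (U n k g)} = insert (L - 2) {L..<n}"
    using 0 gL g3 by (auto simp: U_arc_iff)
  moreover have "L - 1 < n" "L - 1 \<noteq> m" "L - 1 \<noteq> m - 1" using Ln gL m_bounds by auto
  ultimately have "(\<Sum>u\<in>insert (L - 2) {L..<n}. \<bar>y (L - 1)\<bar> - \<bar>y u\<bar>) = q * \<bar>y (L - 1)\<bar>"
    using abs_flux[of "L - 1"] by simp
  then show ?case using leaves_sum_nonpos i gL g3 by simp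
next
  case (Suc d)
  have "{u. (Suc i, u) \<in> parcs (U n k g)} = {i, Suc (Suc i)}"
    using Suc gL g3 by (auto simp: U_arc_iff)
  moreover have "Suc i < n" "Suc i \<noteq> m" "Suc i \<noteq> m - 1" using Suc Ln gL m_bounds by auto
  ultimately have "(\<bar>y (Suc i)\<bar> - \<bar>y i\<bar>) + (\<bar>y (Suc i)\<bar> - \<bar>y (Suc (Suc i))\<bar>) = q * \<bar>y (Suc i)\<bar>"
    using abs_flux[of "Suc i"] by simp
  moreover have "q * \<bar>y (L - 1)\<bar> \<le> \<bar>y (Suc (Suc i))\<bar> - \<bar>y (Suc i)\<bar>"
    using Suc(2-) by (intro Suc.hyps(1)) auto
  moreover have "0 \<le> q * \<bar>y (Suc i)\<bar>" using q_pos by simp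
  ultimately show ?case by linarith
qed

text \<open>By the mirror symmetry the neighbours \<open>0\<close> and \<open>g - 2\<close> have
  equal values, so the two cycle edges share the bound equally; hence the factor 1/2.\<close>

lemma attachment_diff: "q * \<bar>y (L - 1)\<bar> / 2 \<le> \<bar>y (g - 1)\<bar> - \<bar>y (g - 2)\<bar>"
proof -
  have v: "g - 1 < n" "g - 1 \<noteq> m" "g - 1 \<noteq> m - 1" using gn m_bounds by auto
  have y0: "y 0 = y (g - 2)" using mirror[of 0] m_bounds by simp
  have ne: "g - 2 \<noteq> 0" using g3 by simp
  show ?thesis
  proof (cases "L = g")
    case True
    have "{u. (g - 1, u) \<in> parcs (U n k g)} = insert (g - 2) (insert 0 {L..<n})"
      using True gL g3 Ln by (auto simp: U_arc_iff)
    then have "(\<Sum>u\<in>insert (g - 2) (insert 0 {L..<n}). \<bar>y (g - 1)\<bar> - \<bar>y u\<bar>) = q * \<bar>y (g - 1)\<bar>"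
      using abs_flux[OF v] by simp
    then have "2 * (\<bar>y (g - 1)\<bar> - \<bar>y (g - 2)\<bar>) + (\<Sum>j = L..<n. \<bar>y (L - 1)\<bar> - \<bar>y j\<bar>) = q * \<bar>y (g - 1)\<bar>"
      using True ne gL g3 y0 by simp
    then show ?thesis using leaves_sum_nonpos True by simp
  next
    case False
    have "{u. (g - 1, u) \<in> parcs (U n k g)} = {g - 2, 0, g}"
      using False gL g3 by (auto simp: U_arc_iff)
    then have "(\<Sum>u\<in>{g - 2, 0, g}. \<bar>y (g - 1)\<bar> - \<bar>y u\<bar>) = q * \<bar>y (g - 1)\<bar>"
      using abs_flux[OF v] by simp
    then have "2 * (\<bar>y (g - 1)\<bar> - \<bar>y (g - 2)\<bar>) - (\<bar>y g\<bar> - \<bar>y (g - 1)\<bar>) = q * \<bar>y (g - 1)\<bar>"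
      using ne g3 y0 by simp
    moreover have "q * \<bar>y (L - 1)\<bar> \<le> \<bar>y (Suc (g - 1))\<bar> - \<bar>y (g - 1)\<bar>"
      using False gL g3 by (intro tail_diff) auto
    moreover have "0 \<le> q * \<bar>y (g - 1)\<bar>" using q_pos by simp
    ultimately show ?thesis using g3 by simp
  qed
qed

lemma cycle_diff:
  assumes "m \<le> i" "Suc i < g"
  shows "q * \<bar>y (L - 1)\<bar> / 2 \<le> \<bar>y (Suc i)\<bar> - \<bar>y i\<bar>"
  using assms
proof (induction "g - Suc (Suc i)" arbitrary: i)
  case 0
  then have "Suc i = g - 1" "i = g - 2" by auto
  then show ?case using attachment_diff by simp
next
  case (Suc d)
  have "{u. (Suc i, u) \<in> parcs (U n k g)} = {i, Suc (Suc i)}"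
    using Suc gL g3 by (auto simp: U_arc_iff)
  moreover have "Suc i < n" "Suc i \<noteq> m" "Suc i \<noteq> m - 1" using Suc Ln gL m_bounds by auto
  ultimately have "(\<bar>y (Suc i)\<bar> - \<bar>y i\<bar>) + (\<bar>y (Suc i)\<bar> - \<bar>y (Suc (Suc i))\<bar>) = q * \<bar>y (Suc i)\<bar>"
    using abs_flux[of "Suc i"] by simp
  moreover have "q * \<bar>y (L - 1)\<bar> / 2 \<le> \<bar>y (Suc (Suc i))\<bar> - \<bar>y (Suc i)\<bar>"
    using Suc(2-) by (intro Suc.hyps(1)) auto
  moreover have "0 \<le> q * \<bar>y (Suc i)\<bar>" using q_pos by simp
  ultimately show ?case by linarith
qed

lemma core_diff:
  assumes "m \<le> i" "Suc i < L"
  shows "q * \<bar>y (L - 1)\<bar> / 2 \<le> \<bar>y (Suc i)\<bar> - \<bar>y i\<bar>"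
proof (cases "Suc i < g")
  case False
  then have "q * \<bar>y (L - 1)\<bar> \<le> \<bar>y (Suc i)\<bar> - \<bar>y i\<bar>" using assms by (intro tail_diff) auto
  moreover have "0 \<le> q * \<bar>y (L - 1)\<bar>" using q_pos by simp
  ultimately show ?thesis by linarith
qed (use cycle_diff assms in auto)

text \<open>Representative, between \<open>m\<close> and \<open>L\<close>, of the vertices that the
  mirror symmetry and the interchange of leaves force to have the same value.\<close>

definition rank :: "nat \<Rightarrow> nat" where
  "rank i = (if i < m then g - 2 - i else min i L)"

lemma rank_bounds: "m \<le> rank i" "rank i \<le> L"
  using m_bounds gL unfolding rank_def by auto

lemma y_rank: "i < n \<Longrightarrow> y (rank i) = y i"
proof (cases "L \<le> i")
  case True
  assume "i < n"
  then have "(1 - q) * y i = (1 - q) * y L"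
    using leaf_equation[of i] leaf_equation[of L] True Ln by simp
  then show ?thesis using True q_less_1 m_bounds gL by (simp add: rank_def)
qed (use mirror in \<open>auto simp: rank_def\<close>)

text \<open>Absolute values do not decrease towards the centre, so a zero there annihilates the core
  from \<open>m\<close> on. The leaf equation then annihilates the leaves, and the mirror symmetry
  the rest.\<close>

lemma center_nonzero: "y (L - 1) \<noteq> 0"
proof
  assume z: "y (L - 1) = 0"
  have "\<bar>y i\<bar> \<le> \<bar>y (L - 1)\<bar>" if "m \<le> i" "i < L" for i
    using that
  proof (induction "L - Suc i" arbitrary: i)
    case 0
    then have "i = L - 1" by auto
    then show ?case by simp
  next
    case (Suc d)
    then have "\<bar>y (Suc i)\<bar> \<le> \<bar>y (L - 1)\<bar>" by auto
    moreover have "\<bar>y i\<bar> \<le> \<bar>y (Suc i)\<bar>" using core_diff[of i] Suc z by simp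
    ultimately show ?case by linarith
  qed
  then have c: "y i = 0" if "m \<le> i" "i < L" for i using that z by fastforce
  moreover have "y L = 0" using leaf_equation[of L] Ln z q_less_1 by simp
  ultimately have "y (rank i) = 0" for i
    using rank_bounds[of i] by (cases "rank i = L") auto
  then have "sqnorm (U n k g) y = 0" using y_rank by (simp add: sqnorm_U)
  then show False using pos by simp
qed

lemma abs_strict_mono:
  assumes "m \<le> i" "i < j" "j \<le> L"
  shows "\<bar>y i\<bar> < \<bar>y j\<bar>"
  using assms(2,3)
proof (induction j)
  case (Suc j)
  have "\<bar>y j\<bar> < \<bar>y (Suc j)\<bar>"
  proof (cases "Suc j < L")
    case True
    have "0 < q * \<bar>y (L - 1)\<bar>" using q_pos center_nonzero by simp
    then show ?thesis using core_diff[of j] True Suc assms(1) by simp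
  next
    case False
    then have j: "Suc j = L" "j = L - 1" using Suc by auto
    have "y L \<noteq> 0" using leaf_equation[of L] Ln center_nonzero by auto
    then have "0 < q * \<bar>y L\<bar>" using q_pos by simp
    then show ?thesis using leaf_diff[of L] Ln j by simp
  qed
  then show ?case using Suc by (cases "i = j") auto
qed simp

lemma minimizer_nonzero: "i < n \<Longrightarrow> y i \<noteq> 0"
proof -
  assume i: "i < n"
  have "\<bar>y m\<bar> < \<bar>y (Suc m)\<bar>" using m_bounds gL by (intro abs_strict_mono) auto
  \<comment> \<open>By \<open>abs_flux_m\<close>, a zero at \<open>m\<close> would give a zero at
    \<open>Suc m\<close>, against the strict increase.\<close>
  then have "y m \<noteq> 0" using abs_flux_m by auto
  then have "y (rank i) \<noteq> 0"
    using abs_strict_mono[of m "rank i"] rank_bounds[of i] by (cases "rank i = m") auto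
  then show ?thesis using y_rank[OF i] by simp
qed

lemma minimizer_abs_eq:
  assumes "i < n" "j < n" "\<bar>y i\<bar> = \<bar>y j\<bar>"
  shows "rank i = rank j" "y i = y j"
proof -
  show "rank i = rank j"
    using abs_strict_mono[of "rank i" "rank j"] abs_strict_mono[of "rank j" "rank i"]
      rank_bounds[of i] rank_bounds[of j] y_rank assms by (metis less_irrefl linorder_neqE_nat)
  then show "y i = y j" using y_rank assms by metis
qed

text \<open>Values that agree up to sign agree outright, because they share their
  \<open>rank\<close>, and no value is zero.\<close>

lemma minimizer_no_opposite:
  assumes "i < n" "j < n"
  shows "y i + y j \<noteq> 0"
proof
  assume "y i + y j = 0"
  then have "y i = - y j" by simp
  then show False using minimizer_abs_eq(2)[OF assms] minimizer_nonzero[OF assms(1)] by simp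
qed

lemma minimizer_center_unique:
  assumes "i < L" "\<bar>y i\<bar> = \<bar>y (L - 1)\<bar>"
  shows "i = L - 1"
proof -
  have "rank i = rank (L - 1)" using assms Ln by (intro minimizer_abs_eq(1)) auto
  then show ?thesis using assms(1) gL g3 m_bounds unfolding rank_def by (auto split: if_splits)
qed

lemma minimizer_leaf:
  assumes "L \<le> j" "j < n"
  shows "y j = y L" "\<bar>y (L - 1)\<bar> < \<bar>y j\<bar>"
proof -
  show yj: "y j = y L" using y_rank[OF assms(2)] assms m_bounds gL by (simp add: rank_def)
  show "\<bar>y (L - 1)\<bar> < \<bar>y j\<bar>" unfolding yj using m_bounds gL by (intro abs_strict_mono) auto
qed

end

end

section \<open>Strict monotonicity of the least eigenvalue in \<open>k\<close>\<close>

lemma q_min_U_strict_mono_step: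
  assumes "odd g" "3 \<le> g" "g < n" "1 \<le> k" "Suc k \<le> n - g"
  shows "q_min (U n k g) < q_min (U n (Suc k) g)"
proof -
  define L where "L = n - Suc k"
  interpret A: lollipop_star n k g "Suc L"
    using assms unfolding L_def by unfold_locales auto
  interpret B: lollipop_star n "Suc k" g L
    using assms unfolding L_def by unfold_locales auto
  obtain y where y: "sqnorm (U n (Suc k) g) y = 1" "qform (U n (Suc k) g) y = B.q"
    using q_min_attained[OF B.pair_graph_U B.pverts_U_ne] by blast
  then have min: "qform (U n (Suc k) g) y = B.q * sqnorm (U n (Suc k) g) y"
    "0 < sqnorm (U n (Suc k) g) y" by auto
  \<comment> \<open>Leaf \<open>L\<close> becomes the new centre, and the other leaves move to it
    with the value opposite to its own. The norm stays the same and the moved edges cost nothing,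
    whereas before the move each had positive energy.\<close>
  define x where "x i = (if i \<le> L then y i else - y L)" for i
  have "(x i)\<^sup>2 = (y i)\<^sup>2" if "i < n" for i
    using B.minimizer_leaf(1)[OF min, of i] that by (auto simp: x_def)
  then have N: "sqnorm (U n k g) x = sqnorm (U n (Suc k) g) y"
    unfolding A.sqnorm_U B.sqnorm_U by simp
  define P where "P = (\<Sum>i<L - 1. (y i + y (Suc i))\<^sup>2) + (y (g - 1) + y 0)\<^sup>2 + (y (L - 1) + y L)\<^sup>2"
  have L: "L = Suc (L - 1)" using B.gL assms(2) by simp
  have "(\<Sum>i<L. (x i + x (Suc i))\<^sup>2) = (\<Sum>i\<in>insert (L - 1) {..<L - 1}. (y i + y (Suc i))\<^sup>2)"
    using L by (intro sum.cong) (auto simp: x_def)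
  also have "\<dots> = (\<Sum>i<L - 1. (y i + y (Suc i))\<^sup>2) + (y (L - 1) + y L)\<^sup>2"
    using L by simp
  finally have QA: "qform (U n k g) x = P"
    unfolding A.qform_U P_def using B.gL by (simp add: x_def le_diff_conv)
  have "{L..<n} = insert L {Suc L..<n}" using B.Ln by auto
  then have QB: "qform (U n (Suc k) g) y = P + (\<Sum>j = Suc L..<n. (y (L - 1) + y j)\<^sup>2)"
    unfolding B.qform_U P_def by simp
  have "0 < (\<Sum>j = Suc L..<n. (y (L - 1) + y j)\<^sup>2)"
  proof (rule sum_pos)
    show "{Suc L..<n} \<noteq> {}" using assms by (auto simp: L_def)
    fix j assume "j \<in> {Suc L..<n}"
    then show "0 < (y (L - 1) + y j)\<^sup>2"
      using B.minimizer_no_opposite[OF min, of "L - 1" j] B.Ln less_imp_diff_less[of L n 1] by auto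
  qed simp
  then have "qform (U n k g) x < B.q" using QA QB y(2) by simp
  then show ?thesis using A.q_le[of x] N y(1) by simp
qed

lemma q_min_U_strict_mono:
  assumes "odd g" "3 \<le> g" "g < n" "1 \<le> k" "k < l" "l \<le> n - g"
  shows "q_min (U n k g) < q_min (U n l g)"
  using assms(5,6)
proof (induction l)
  case (Suc l)
  have "q_min (U n l g) < q_min (U n (Suc l) g)"
    using assms Suc by (intro q_min_U_strict_mono_step) auto
  then show ?case using Suc by (cases "k = l") auto
qed simp

section \<open>Lollipops in a dominated graph\<close>

lemma cycle_list_arc: "cycle_list E cs \<Longrightarrow> Suc i < length cs \<Longrightarrow> (cs ! i, cs ! Suc i) \<in> E"
  unfolding cycle_list_def by (metis Suc_lessD mod_less)

lemma cycle_list_rotate: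
  assumes "cycle_list E cs"
  shows "cycle_list E (rotate k cs)"
proof -
  let ?m = "length cs"
  have m: "?m > 0" using assms by (simp add: cycle_list_def)
  have "(rotate k cs ! i, rotate k cs ! (Suc i mod ?m)) \<in> E" if "i < ?m" for i
  proof -
    have "rotate k cs ! (Suc i mod ?m) = cs ! ((k + Suc i mod ?m) mod ?m)"
      using m by (intro nth_rotate) simp
    also have "(k + Suc i mod ?m) mod ?m = Suc ((k + i) mod ?m) mod ?m"
      by (metis add_Suc_right mod_Suc_eq mod_add_right_eq)
    finally show ?thesis
      using assms that m by (simp add: cycle_list_def nth_rotate)
  qed
  then show ?thesis using assms by (simp add: cycle_list_def)
qed

lemma cycle_list_relpow:
  assumes "cycle_list E cs" "i \<le> j"
  shows "(cs ! (i mod length cs), cs ! (j mod length cs)) \<in> E ^^ (j - i)"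
proof (rule relpow_nth[of j])
  show "(cs ! (t mod length cs), cs ! (Suc t mod length cs)) \<in> E" for t
    using assms(1) unfolding cycle_list_def by (metis length_greater_0_conv mod_Suc_eq mod_less_divisor)
qed (use assms in auto)

text \<open>\<open>s\<close> assigns dominators. \<open>maximal\<close> and \<open>internal\<close>
  record the two choices on which the argument rests: the shortest odd cycle meets \<open>S\<close>
  as often as possible, and a cycle vertex outside \<open>S\<close> is dominated from within the
  cycle if it can be.\<close>

locale dominated_odd_cycle = pair_graph G for G :: "'a pair_pre_digraph" +
  fixes S :: "'a set" and g :: nat and cs :: "'a list" and s :: "'a \<Rightarrow> 'a"
  assumes conn: "\<And>u v. u \<in> pverts G \<Longrightarrow> v \<in> pverts G \<Longrightarrow> (u, v) \<in> (parcs G)\<^sup>*"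
    and S_verts: "S \<subseteq> pverts G"
    and cyc: "cycle_list (parcs G) cs" and len_cs: "length cs = g" and odd_g: "odd g" and g3: "3 \<le> g"
    and girth: "\<And>u l. odd l \<Longrightarrow> (u, u) \<in> parcs G ^^ l \<Longrightarrow> g \<le> l"
    and maximal: "\<And>cs'. cycle_list (parcs G) cs' \<Longrightarrow> length cs' = g \<Longrightarrow>
      card (set cs' \<inter> S) \<le> card (set cs \<inter> S)"
    and dom: "\<And>v. v \<in> pverts G \<Longrightarrow> v \<notin> S \<Longrightarrow> s v \<in> S \<and> (v, s v) \<in> parcs G"
    and internal: "\<And>v u. v \<in> set cs \<Longrightarrow> v \<notin> S \<Longrightarrow> u \<in> set cs \<Longrightarrow> u \<in> S \<Longrightarrow>
      (v, u) \<in> parcs G \<Longrightarrow> s v \<in> set cs"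
begin

lemma cs_verts: "set cs \<subseteq> pverts G"
proof
  fix v assume "v \<in> set cs"
  then obtain i where "i < length cs" "v = cs ! i" by (auto simp: in_set_conv_nth)
  then show "v \<in> pverts G" using cyc in_arcsD1 unfolding cycle_list_def by blast
qed

text \<open>The arc cuts the cycle into two closed walks whose lengths add up to
  \<open>g + 2\<close>. Exactly one is odd, and by \<open>girth\<close> it has length at least
  \<open>g\<close>; the other then has length 2, so the arc is a cycle edge.\<close>

lemma cycle_list_chord:
  assumes c: "cycle_list (parcs G) xs" "length xs = g"
    and ij: "i < j" "j < g" and arc: "(xs ! i, xs ! j) \<in> parcs G"
  shows "j = Suc i \<or> i = 0 \<and> j = g - 1"
proof (cases "even (j - i)")
  case True
  have "(xs ! i, xs ! j) \<in> parcs G ^^ (j - i)"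
    using cycle_list_relpow[OF c(1), of i j] c(2) ij by simp
  then have "(xs ! i, xs ! i) \<in> parcs G ^^ Suc (j - i)"
    using arcs_symmetric[OF arc] by auto
  then have "g \<le> Suc (j - i)" using girth True by simp
  then show ?thesis using ij by auto
next
  case False
  have "(xs ! j, xs ! i) \<in> parcs G ^^ (i + g - j)"
    using cycle_list_relpow[OF c(1), of j "i + g"] c(2) ij by simp
  then have "(xs ! j, xs ! j) \<in> parcs G ^^ Suc (i + g - j)"
    using arc by auto
  moreover have "odd (Suc (i + g - j))" using False odd_g ij by presburger
  ultimately have "g \<le> Suc (i + g - j)" using girth by blast
  then show ?thesis using ij by auto
qed

text \<open>Going from position \<open>j\<close> on around to \<open>i\<close> and back through
  \<open>t\<close> is an odd closed walk, so \<open>girth\<close> forces \<open>j = i + 2\<close>.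
  Replacing the vertex in between, which is not in \<open>S\<close>, by \<open>t\<close> yields a
  shortest odd cycle with one more vertex in \<open>S\<close>, against
  \<open>maximal\<close>.\<close>

lemma swap_common_neighbour:
  assumes c: "cycle_list (parcs G) xs" "length xs = g" and set_xs: "set xs = set cs"
    and ij: "i < j" "j < g" "even (j - i)"
    and t: "t \<in> S" "t \<notin> set cs" "(xs ! i, t) \<in> parcs G" "(xs ! j, t) \<in> parcs G"
    and none: "\<And>u. u \<in> set cs \<Longrightarrow> u \<in> S \<Longrightarrow> (xs ! i, u) \<notin> parcs G"
  shows False
proof -
  have "(xs ! j, xs ! i) \<in> parcs G ^^ (i + g - j)"
    using cycle_list_relpow[OF c(1), of j "i + g"] c(2) ij by simp
  then have "(xs ! j, xs ! j) \<in> parcs G ^^ Suc (Suc (i + g - j))"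
    using t arcs_symmetric by auto
  moreover have "odd (Suc (Suc (i + g - j)))" using odd_g ij by presburger
  ultimately have "g \<le> Suc (Suc (i + g - j))" using girth by blast
  then have j: "j = Suc (Suc i)" using ij by presburger
  define xs' where "xs' = xs[Suc i := t]"
  have d: "distinct xs" using c(1) by (simp add: cycle_list_def)
  have "cycle_list (parcs G) xs'"
    unfolding cycle_list_def
  proof (intro conjI allI impI)
    show "distinct xs'" using d t(2) set_xs unfolding xs'_def by (simp add: distinct_list_update)
    show "xs' \<noteq> []" using c by (simp add: xs'_def cycle_list_def)
    fix l assume l: "l < length xs'"
    then have lg: "l < g" using c by (simp add: xs'_def)
    consider "l = i" | "l = Suc i" | "l \<noteq> i" "l \<noteq> Suc i" by blast
    then show "(xs' ! l, xs' ! (Suc l mod length xs')) \<in> parcs G"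
    proof cases
      case 1
      then show ?thesis using t c j ij by (simp add: xs'_def)
    next
      case 2
      then show ?thesis using arcs_symmetric[OF t(4)] c j ij by (simp add: xs'_def)
    next
      case 3
      then have "Suc l mod g \<noteq> Suc i" using lg by (cases "Suc l = g") auto
      then show ?thesis using 3 c lg by (simp add: xs'_def cycle_list_def)
    qed
  qed
  moreover have "length xs' = g" using c by (simp add: xs'_def)
  ultimately have "card (set xs' \<inter> S) \<le> card (set cs \<inter> S)" by (rule maximal)
  moreover have "set xs' \<inter> S = insert t (set cs \<inter> S)"
  proof -
    have "xs ! Suc i \<notin> S"
    proof -
      have "(xs ! i, xs ! Suc i) \<in> parcs G"
        using cycle_list_arc[OF c(1), of i] c ij j by simp
      moreover have "xs ! Suc i \<in> set cs" using c ij j set_xs nth_mem[of "Suc i" xs] by simp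
      ultimately show ?thesis using none by blast
    qed
    moreover have "set xs' = insert t (set xs - {xs ! Suc i})"
      unfolding xs'_def using d c ij j by (intro set_update_distinct) auto
    ultimately show ?thesis using t(1) set_xs by auto
  qed
  ultimately show False using t(2) by simp
qed

lemma no_common_dominator:
  assumes uv: "u \<in> set cs" "v \<in> set cs" "u \<noteq> v" "u \<notin> S" "v \<notin> S"
    and su: "s u = s v" "s u \<notin> set cs"
  shows False
proof -
  \<comment> \<open>A neighbour in \<open>S\<close> on the cycle would, by \<open>internal\<close>,
    put the dominator on the cycle.\<close>
  have ncs: "(a, b) \<notin> parcs G" if "a \<in> {u, v}" "b \<in> set cs" "b \<in> S" for a b
    using internal[of a b] that uv su by auto
  have t: "s u \<in> S" "(u, s u) \<in> parcs G" "(v, s u) \<in> parcs G"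
    using dom[of u] dom[of v] uv su(1) cs_verts by auto
  have tw: "(w, s u) \<in> parcs G" if "w \<in> {u, v}" for w using that t by blast
  have *: False if ij: "i < j" "j < g" and ci: "cs ! i \<in> {u, v}" and cj: "cs ! j \<in> {u, v}" for i j
  proof (cases "even (j - i)")
    case True
    show False
      by (rule swap_common_neighbour[OF cyc len_cs refl ij True t(1) su(2) tw[OF ci] tw[OF cj]])
        (rule ncs[OF ci])
  next
    case False
    \<comment> \<open>At odd distance the complementary part of the odd cycle has even length, so
      the cycle is read anew from position \<open>j\<close>.\<close>
    have r: "rotate j cs ! 0 = cs ! j" "rotate j cs ! (i + g - j) = cs ! i"
      using ij len_cs by (simp_all add: nth_rotate)
    have e: "even (i + g - j - 0)" "0 < i + g - j" "i + g - j < g" using False ij odd_g by presburger+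
    have l: "length (rotate j cs) = g" "set (rotate j cs) = set cs" using len_cs by simp_all
    show False
      by (rule swap_common_neighbour[OF cycle_list_rotate[OF cyc] l e(2,3,1) t(1) su(2)])
        (use r tw[OF ci] tw[OF cj] ncs[OF cj] in auto)
  qed
  obtain i j where "i < g" "j < g" "u = cs ! i" "v = cs ! j"
    using uv len_cs by (metis in_set_conv_nth)
  then show False using *[of i j] *[of j i] uv(3) by (cases "i < j"; cases "j < i") auto
qed

section \<open>Cheapest paths from the cycle\<close>

text \<open>
  Walks from the cycle are charged for the edges that do not join a vertex to its dominator.
\<close>

definition cost :: "'a \<Rightarrow> 'a \<Rightarrow> nat" where
  "cost u v = (if u \<notin> S \<and> s u = v \<or> v \<notin> S \<and> s v = u then 0 else 1)"

inductive walk :: "nat \<Rightarrow> nat \<Rightarrow> 'a \<Rightarrow> bool" where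
  start: "v \<in> set cs \<Longrightarrow> walk 0 0 v"
| step: "walk c l u \<Longrightarrow> (u, v) \<in> parcs G \<Longrightarrow> walk (c + cost u v) (Suc l) v"

definition dist_cost :: "'a \<Rightarrow> nat" where
  "dist_cost v = (LEAST c. \<exists>l. walk c l v)"

text \<open>Ties in cost are broken by length. Thus steps of cost 0 make progress too, and optimal
  paths do not repeat vertices.\<close>

definition dist_len :: "'a \<Rightarrow> nat" where
  "dist_len v = (LEAST l. walk (dist_cost v) l v)"

lemma walk_exists:
  assumes "v \<in> pverts G"
  shows "\<exists>c l. walk c l v"
proof -
  have "cs ! 0 \<in> set cs" using len_cs g3 by simp
  then have "(cs ! 0, v) \<in> (parcs G)\<^sup>*" using conn cs_verts assms by blast
  then show ?thesis
  proof (induction rule: rtrancl_induct)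
    case base
    then show ?case using walk.start \<open>cs ! 0 \<in> set cs\<close> by blast
  next
    case (step y z)
    then show ?case using walk.step by blast
  qed
qed

lemma walk_dist: "v \<in> pverts G \<Longrightarrow> walk (dist_cost v) (dist_len v) v"
  unfolding dist_len_def dist_cost_def
  by (intro LeastI_ex[of "\<lambda>l. walk _ l v"] LeastI_ex[of "\<lambda>c. \<exists>l. walk c l v"] walk_exists)

lemma dist_cost_le: "walk c l v \<Longrightarrow> dist_cost v \<le> c"
  unfolding dist_cost_def by (intro Least_le) blast

lemma dist_len_le: "walk (dist_cost v) l v \<Longrightarrow> dist_len v \<le> l"
  unfolding dist_len_def by (intro Least_le)

lemma dist_cycle:
  assumes "v \<in> set cs"
  shows "dist_cost v = 0" "dist_len v = 0"
proof -
  show c: "dist_cost v = 0" using dist_cost_le[OF walk.start[OF assms]] by simp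
  show "dist_len v = 0" using dist_len_le[of v 0] walk.start[OF assms] c by simp
qed

lemma dist_cost_step:
  assumes "(u, v) \<in> parcs G"
  shows "dist_cost v \<le> dist_cost u + cost u v"
  using dist_cost_le[OF walk.step[OF walk_dist assms]] in_arcsD1[OF assms] by blast

lemma dist_predecessor:
  assumes "v \<in> pverts G" "v \<notin> set cs"
  obtains u where "(u, v) \<in> parcs G" "dist_cost v = dist_cost u + cost u v" "dist_len u < dist_len v"
proof -
  from walk_dist[OF assms(1)] show ?thesis
  proof cases
    case start
    then show ?thesis using assms(2) by simp
  next
    case (step c l u)
    have "dist_cost u \<le> c" "dist_cost v \<le> dist_cost u + cost u v"
      using dist_cost_le dist_cost_step step by blast+
    then have "c = dist_cost u" using step by linarith
    then have "dist_len u \<le> l" using dist_len_le step by blast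
    then show ?thesis using that[of u] step \<open>c = dist_cost u\<close> by simp
  qed
qed

text \<open>Each step is tight for the cost. The increase of \<open>dist_len\<close> keeps the
  vertices distinct and all but the first off the cycle.\<close>

definition geodesic :: "'a list \<Rightarrow> bool" where
  "geodesic T \<longleftrightarrow> T \<noteq> [] \<and> hd T \<in> set cs \<and> (\<forall>i. Suc i < length T \<longrightarrow>
     (T ! i, T ! Suc i) \<in> parcs G \<and>
     dist_cost (T ! Suc i) = dist_cost (T ! i) + cost (T ! i) (T ! Suc i) \<and>
     dist_len (T ! i) < dist_len (T ! Suc i))"

lemma geodesic_exists: "v \<in> pverts G \<Longrightarrow> \<exists>T. geodesic T \<and> last T = v"
proof (induction "dist_len v" arbitrary: v rule: less_induct)
  case less
  show ?case
  proof (cases "v \<in> set cs")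
    case True
    then show ?thesis by (intro exI[of _ "[v]"]) (simp add: geodesic_def)
  next
    case False
    obtain u where u: "(u, v) \<in> parcs G" "dist_cost v = dist_cost u + cost u v" "dist_len u < dist_len v"
      using dist_predecessor less.prems False by blast
    obtain T where T: "geodesic T" "last T = u" using less.hyps u in_arcsD1 by blast
    have "geodesic (T @ [v])"
      unfolding geodesic_def
    proof (intro conjI allI impI)
      show "T @ [v] \<noteq> []" "hd (T @ [v]) \<in> set cs" using T(1) by (auto simp: geodesic_def)
      fix i assume "Suc i < length (T @ [v])"
      then consider "Suc i < length T" | "Suc i = length T" by fastforce
      then have "((T @ [v]) ! i, (T @ [v]) ! Suc i) \<in> parcs G \<and>
        dist_cost ((T @ [v]) ! Suc i)
          = dist_cost ((T @ [v]) ! i) + cost ((T @ [v]) ! i) ((T @ [v]) ! Suc i) \<and>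
        dist_len ((T @ [v]) ! i) < dist_len ((T @ [v]) ! Suc i)"
      proof cases
        case 1
        then show ?thesis using T(1) by (simp add: geodesic_def nth_append)
      next
        case 2
        then have "T ! i = u" using T by (metis diff_Suc_1 last_conv_nth geodesic_def)
        then show ?thesis using u 2 by (simp add: nth_append)
      qed
      then show "((T @ [v]) ! i, (T @ [v]) ! Suc i) \<in> parcs G"
        "dist_cost ((T @ [v]) ! Suc i)
          = dist_cost ((T @ [v]) ! i) + cost ((T @ [v]) ! i) ((T @ [v]) ! Suc i)"
        "dist_len ((T @ [v]) ! i) < dist_len ((T @ [v]) ! Suc i)" by blast+
    qed
    then show ?thesis by (intro exI[of _ "T @ [v]"]) simp
  qed
qed

section \<open>Dominators of the vertices on the cycle and on a geodesic\<close>

context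
  fixes T :: "'a list"
  assumes T: "geodesic T"
begin

lemma T_arc: "Suc i < length T \<Longrightarrow> (T ! i, T ! Suc i) \<in> parcs G"
  and T_cost: "Suc i < length T \<Longrightarrow> dist_cost (T ! Suc i) = dist_cost (T ! i) + cost (T ! i) (T ! Suc i)"
  and T_len: "Suc i < length T \<Longrightarrow> dist_len (T ! i) < dist_len (T ! Suc i)"
  and T_ne: "T \<noteq> []"
  using T by (auto simp: geodesic_def)

lemma T_0: "T ! 0 \<in> set cs"
  using T by (metis geodesic_def hd_conv_nth)

lemma T_cost_mono: "i \<le> j \<Longrightarrow> j < length T \<Longrightarrow> dist_cost (T ! i) \<le> dist_cost (T ! j)"
proof (induction j)
  case (Suc j)
  then show ?case using T_cost[of j] by (cases "i = Suc j") auto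
qed simp

lemma T_len_mono: "i < j \<Longrightarrow> j < length T \<Longrightarrow> dist_len (T ! i) < dist_len (T ! j)"
proof (induction j)
  case (Suc j)
  then show ?case using T_len[of j] by (cases "i = j") auto
qed simp

lemma T_eq_iff: "i < length T \<Longrightarrow> j < length T \<Longrightarrow> T ! i = T ! j \<longleftrightarrow> i = j"
  by (metis T_len_mono less_irrefl linorder_neqE_nat)

lemma T_outside: "0 < i \<Longrightarrow> i < length T \<Longrightarrow> T ! i \<notin> set cs"
  using T_len_mono[of 0 i] dist_cycle(2) by fastforce

lemma T_verts: "i < length T \<Longrightarrow> T ! i \<in> pverts G"
  using T_0 cs_verts T_arc in_arcsD2 by (cases i) auto

text \<open>A step of cost 0 joins a vertex to its dominator. Dominators lie in \<open>S\<close>, so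
  an end outside \<open>S\<close> is the dominated one.\<close>

lemma T_free_step:
  assumes "Suc i < length T" "T ! Suc i \<notin> S" "dist_cost (T ! Suc i) \<le> dist_cost (T ! i)"
  shows "s (T ! Suc i) = T ! i"
proof -
  have "cost (T ! i) (T ! Suc i) = 0" using T_cost[OF assms(1)] assms(3) by simp
  then show ?thesis
    using dom[of "T ! i"] T_verts[of i] assms unfolding cost_def by (auto split: if_splits)
qed

lemma T_free_step_back:
  assumes "Suc i < length T" "T ! i \<notin> S" "dist_cost (T ! Suc i) \<le> dist_cost (T ! i)"
  shows "s (T ! i) = T ! Suc i"
proof -
  have "cost (T ! i) (T ! Suc i) = 0" using T_cost[OF assms(1)] assms(3) by simp
  then show ?thesis
    using dom[of "T ! Suc i"] T_verts[of "Suc i"] assms unfolding cost_def by (auto split: if_splits)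
qed

text \<open>The edge to the dominator is free in both directions.\<close>

lemma dist_cost_dominator: "v \<in> pverts G \<Longrightarrow> v \<notin> S \<Longrightarrow> dist_cost (s v) = dist_cost v"
proof -
  assume v: "v \<in> pverts G" "v \<notin> S"
  then have "(v, s v) \<in> parcs G" using dom by blast
  then have "dist_cost (s v) \<le> dist_cost v + cost v (s v)" "dist_cost v \<le> dist_cost (s v) + cost (s v) v"
    using dist_cost_step arcs_symmetric by blast+
  moreover have "cost v (s v) = 0" "cost (s v) v = 0" using v by (auto simp: cost_def)
  ultimately show ?thesis by simp
qed

text \<open>A dominator on the cycle has cost 0, hence so has the tail vertex, and the step into it
  is free.\<close>

lemma tail_dominator_cycle:
  assumes "Suc i < length T" "T ! Suc i \<notin> S" "s (T ! Suc i) \<in> set cs"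
  shows "s (T ! Suc i) = T ! i"
  using assms dist_cost_dominator[of "T ! Suc i"] T_verts dist_cycle(1)
  by (intro T_free_step) auto

text \<open>The two positions have the same cost, and costs are monotone along \<open>T\<close>, so
  the step next to \<open>T ! i\<close> in the direction of \<open>T ! j\<close> is free and already
  leads to the dominator.\<close>

lemma tail_dominator_tail:
  assumes i: "0 < i" "i < length T" "T ! i \<notin> S" and j: "j < length T" "s (T ! i) = T ! j"
  shows "j = Suc i \<or> i = Suc j"
proof -
  have eq: "dist_cost (T ! j) = dist_cost (T ! i)"
    using dist_cost_dominator[of "T ! i"] T_verts i j by simp
  have "i \<noteq> j"
    using dom[of "T ! i"] T_verts i j by auto
  then consider "j < i" | "i < j" by linarith
  then show ?thesis
  proof cases
    case 1
    then obtain l where l: "i = Suc l" "j \<le> l" by (cases i) auto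
    then have "s (T ! Suc l) = T ! l"
      using T_cost_mono[of j l] eq i by (intro T_free_step) auto
    then show ?thesis using T_eq_iff[of j l] l i j by simp
  next
    case 2
    then have "s (T ! i) = T ! Suc i"
      using T_cost_mono[of "Suc i" j] eq i j by (intro T_free_step_back) auto
    then show ?thesis using T_eq_iff[of j "Suc i"] 2 j by simp
  qed
qed

text \<open>All of \<open>T\<close> up to \<open>j\<close> has cost 0. The step into
  \<open>T ! j\<close> is free, so the vertex before it is dominated by \<open>T ! j\<close>; were
  it not the first, the free step into it would make its predecessor its dominator as well. Hence
  \<open>j = 1\<close>, and \<open>no_common_dominator\<close> identifies \<open>v\<close> with
  \<open>T ! 0\<close>.\<close>

lemma cycle_dominator_tail:
  assumes v: "v \<in> set cs" "v \<notin> S" and j: "0 < j" "j < length T" "s v = T ! j"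
  shows "j = 1 \<and> v = T ! 0"
proof -
  have vV: "v \<in> pverts G" using v cs_verts by blast
  have S: "T ! j \<in> S" using dom[OF vV v(2)] j by simp
  have 0: "dist_cost (T ! l) = 0" if "l \<le> j" for l
    using T_cost_mono[OF that j(2)] dist_cost_dominator[OF vV v(2)] j(3) dist_cycle(1)[OF v(1)] by simp
  obtain i where i: "j = Suc i" using j by (cases j) auto
  have c0: "cost (T ! i) (T ! Suc i) = 0" using T_cost[of i] 0[of i] 0[of "Suc i"] i j by simp
  then have Ti: "T ! i \<notin> S" "s (T ! i) = T ! Suc i"
    using S i unfolding cost_def by (auto split: if_splits)
  have "i = 0"
  proof (rule ccontr)
    assume "i \<noteq> 0"
    then obtain l where l: "i = Suc l" by (cases i) auto
    have "s (T ! Suc l) = T ! l"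
      using Ti l 0[of l] 0[of "Suc l"] i j by (intro T_free_step) auto
    then have "T ! Suc i = T ! l" using Ti l by simp
    then show False using T_eq_iff[of "Suc i" l] i l j by simp
  qed
  moreover have "v = T ! 0"
  proof (rule ccontr)
    assume "v \<noteq> T ! 0"
    then show False
      using no_common_dominator[of v "T ! 0"] v T_0 Ti j i \<open>i = 0\<close> T_outside[of 1] by simp
  qed
  ultimately show ?thesis using i by simp
qed

lemma common_dominator_in_core:
  assumes u: "u \<in> set cs \<union> set T" "u \<notin> S" and v: "v \<in> set cs \<union> set T" "v \<notin> S"
    and "u \<noteq> v" and su: "s u = s v" "s u \<notin> set cs" "s u \<notin> set T"
  shows False
proof -
  \<comment> \<open>A dominator shared with a vertex \<open>b\<close> of no larger cost than
    \<open>T ! i\<close> makes the step into \<open>T ! Suc i\<close> free. The dominator is then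
    \<open>T ! i\<close>, which is not outside the core.\<close>
  have tail: False
    if a: "Suc i < length T" "T ! Suc i \<notin> S" "s (T ! Suc i) = s u"
      and b: "b \<in> pverts G" "b \<notin> S" "s b = s u" "dist_cost b \<le> dist_cost (T ! i)" for i b
  proof -
    have "dist_cost (T ! Suc i) = dist_cost b"
      using dist_cost_dominator[OF b(1,2)] dist_cost_dominator[OF T_verts a(2)] a b by simp
    then have "s (T ! Suc i) = T ! i" using a b by (intro T_free_step) auto
    then show False using a su(3) nth_mem[of i T] by simp
  qed
  have V: "w \<in> pverts G" if "w \<in> set cs \<union> set T" for w
    using that cs_verts T_verts by (metis UnE in_set_conv_nth subsetD)
  have tail_index: "\<exists>i. Suc i < length T \<and> w = T ! Suc i" if "w \<in> set cs \<union> set T" "w \<notin> set cs" for w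
  proof -
    obtain i where "i < length T" "w = T ! i" using \<open>w \<in> _\<close> \<open>w \<notin> set cs\<close> by (auto simp: in_set_conv_nth)
    then show ?thesis using T_0 that(2) by (cases i) auto
  qed
  consider "u \<in> set cs" "v \<in> set cs" | "u \<in> set cs" "v \<notin> set cs" | "u \<notin> set cs" "v \<in> set cs"
    | "u \<notin> set cs" "v \<notin> set cs" by blast
  then show False
  proof cases
    case 1
    then show False using no_common_dominator[of u v] assms by blast
  next
    case 2
    then obtain i where "Suc i < length T" "v = T ! Suc i" using tail_index v by blast
    then show False using tail[of i u] 2 u v su V dist_cycle(1)[of u] by auto
  next
    case 3
    then obtain i where "Suc i < length T" "u = T ! Suc i" using tail_index u by blast
    then show False using tail[of i v] 3 u v su V dist_cycle(1)[of v] by auto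
  next
    case 4
    obtain i j where ij: "Suc i < length T" "u = T ! Suc i" "Suc j < length T" "v = T ! Suc j"
      using tail_index u v 4 by blast
    then have "i \<noteq> j" using \<open>u \<noteq> v\<close> by auto
    then consider "i < j" | "j < i" by linarith
    then show False
    proof cases
      case 1
      then show False using tail[of j u] T_cost_mono[of "Suc i" j] ij u v su V by auto
    next
      case 2
      then show False using tail[of i v] T_cost_mono[of "Suc j" i] ij u v su V by auto
    qed
  qed
qed

end

section \<open>The core: a cycle followed by a geodesic\<close>

definition core_adjacent :: "nat \<Rightarrow> nat \<Rightarrow> bool" where
  "core_adjacent i j \<longleftrightarrow> j = Suc i \<or> i = Suc j \<or> i = 0 \<and> j = g - 1 \<or> i = g - 1 \<and> j = 0"

text \<open>\<open>xs\<close> is the cycle, rotated so that the attachment vertex comes last,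
  followed by the rest of a geodesic to \<open>z\<close>. The last two properties serve to bound the
  domination number of the comparison graph.\<close>

lemma core_list_exists:
  assumes z: "z \<in> pverts G"
  obtains xs where "distinct xs" "set xs \<subseteq> pverts G" "g \<le> length xs" "last xs = z"
    and "\<And>i. Suc i < length xs \<Longrightarrow> (xs ! i, xs ! Suc i) \<in> parcs G"
    and "(xs ! (g - 1), xs ! 0) \<in> parcs G"
    and "\<And>i j. i < length xs \<Longrightarrow> j < length xs \<Longrightarrow> xs ! i \<notin> S \<Longrightarrow> s (xs ! i) = xs ! j \<Longrightarrow>
      core_adjacent i j"
    and "\<And>u v. u \<in> set xs \<Longrightarrow> v \<in> set xs \<Longrightarrow> u \<notin> S \<Longrightarrow> v \<notin> S \<Longrightarrow> s u = s v \<Longrightarrow> s u \<notin> set xs \<Longrightarrow> u = v"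
proof -
  obtain T where T: "geodesic T" "last T = z" using geodesic_exists[OF z] by blast
  obtain i0 where i0: "i0 < g" "T ! 0 = cs ! i0"
    using T_0[OF T(1)] len_cs by (auto simp: in_set_conv_nth)
  define cs' where "cs' = rotate (Suc i0) cs"
  have cyc': "cycle_list (parcs G) cs'" unfolding cs'_def by (rule cycle_list_rotate[OF cyc])
  have cs': "length cs' = g" "set cs' = set cs" using len_cs by (auto simp: cs'_def)
  have "cs' ! (g - 1) = cs ! ((Suc i0 + (g - 1)) mod g)"
    unfolding cs'_def using len_cs g3 by (subst nth_rotate) auto
  also have "Suc i0 + (g - 1) = i0 + g" using g3 by simp
  finally have att: "cs' ! (g - 1) = T ! 0" using i0 by simp
  define xs where "xs = cs' @ tl T"
  have len: "length xs = g + (length T - 1)" by (simp add: xs_def cs')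
  have xc: "xs ! i = cs' ! i" if "i < g" for i using that cs' by (simp add: xs_def nth_append)
  \<comment> \<open>Cycle and geodesic share the attachment vertex, hence the offset
    \<open>g - 1\<close> instead of \<open>g\<close>.\<close>
  have xt: "xs ! (g - 1 + i) = T ! i" if "i < length T" for i
  proof (cases i)
    case 0
    then show ?thesis using att xc[of "g - 1"] g3 by simp
  next
    case (Suc l)
    then show ?thesis using that cs' g3 by (simp add: xs_def nth_append nth_tl)
  qed
  have index: "i < g \<or> (\<exists>l. 0 < l \<and> l < length T \<and> i = g - 1 + l)" if "i < length xs" for i
  proof (cases "i < g")
    case False
    then show ?thesis using that len g3 by (intro disjI2 exI[of _ "i - (g - 1)"]) auto
  qed simp
  have set_xs: "set xs = set cs \<union> set T"
  proof -
    have "set T = insert (T ! 0) (set (tl T))"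
      using T_ne[OF T(1)] by (cases T) auto
    then show ?thesis using T_0[OF T(1)] by (auto simp: xs_def cs')
  qed
  have dist: "distinct xs"
  proof -
    have "distinct T" using T_eq_iff[OF T(1)] by (auto simp: distinct_conv_nth)
    moreover have "set cs' \<inter> set (tl T) = {}"
    proof -
      have "w \<notin> set cs" if "w \<in> set (tl T)" for w
      proof -
        obtain l where "l < length (tl T)" "w = tl T ! l" using \<open>w \<in> _\<close> by (auto simp: in_set_conv_nth)
        then show ?thesis using T_outside[OF T(1), of "Suc l"] by (simp add: nth_tl)
      qed
      then show ?thesis using cs' by auto
    qed
    ultimately show ?thesis using cyc' by (auto simp: xs_def cycle_list_def distinct_tl)
  qed
  have arc: "(xs ! i, xs ! Suc i) \<in> parcs G" if "Suc i < length xs" for i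
  proof (cases "Suc i < g")
    case True
    then have "(cs' ! i, cs' ! Suc i) \<in> parcs G"
      using cycle_list_arc[OF cyc'] cs' by simp
    then show ?thesis using True xc by simp
  next
    case False
    define l where "l = i - (g - 1)"
    have "i = g - 1 + l" "Suc l < length T" using False that len g3 unfolding l_def by auto
    then show ?thesis using xt[of l] xt[of "Suc l"] T_arc[OF T(1), of l] by simp
  qed
  have adj: "core_adjacent i j"
    if ij: "i < length xs" "j < length xs" "xs ! i \<notin> S" "s (xs ! i) = xs ! j" for i j
  proof -
    have xV: "xs ! i \<in> pverts G"
      using nth_mem[OF ij(1)] set_xs cs_verts T_verts[OF T(1)] by (metis UnE in_set_conv_nth subset_iff)
    \<comment> \<open>Between two cycle positions a chord is excluded; between cycle and tail only
      the edge at the attachment vertex remains; two tail positions are consecutive.\<close>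
    consider "i < g" "j < g" | l where "i < g" "0 < l" "l < length T" "j = g - 1 + l"
      | l where "0 < l" "l < length T" "i = g - 1 + l" "j < g"
      | l r where "0 < l" "l < length T" "i = g - 1 + l" "0 < r" "r < length T" "j = g - 1 + r"
      using index[OF ij(1)] index[OF ij(2)] by blast
    then show ?thesis
    proof cases
      case 1
      have a: "(cs' ! i, cs' ! j) \<in> parcs G" using dom[OF xV ij(3)] ij(4) xc 1 by simp
      then have "i \<noteq> j" using no_loops' by blast
      then consider "i < j" | "j < i" by linarith
      then show ?thesis
      proof cases
        case 1
        then show ?thesis
          using cycle_list_chord[OF cyc' cs'(1) _ _ a] \<open>j < g\<close> unfolding core_adjacent_def by auto
      next
        case 2
        then show ?thesis
          using cycle_list_chord[OF cyc' cs'(1) _ _ arcs_symmetric[OF a]] \<open>i < g\<close>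
          unfolding core_adjacent_def by auto
      qed
    next
      case (2 l)
      have "xs ! i \<in> set cs" using xc 2 cs' nth_mem by metis
      then have l: "l = 1" "xs ! i = T ! 0"
        using cycle_dominator_tail[OF T(1), of "xs ! i" l] ij 2 xt[of l] by auto
      then have "cs' ! i = cs' ! (g - 1)" using att xc 2 by simp
      then have "i = g - 1"
        using cyc' cs' 2 g3 by (simp add: cycle_list_def nth_eq_iff_index_eq)
      then show ?thesis using l 2 by (simp add: core_adjacent_def)
    next
      case (3 l)
      then obtain r where r: "l = Suc r" by (cases l) auto
      have "xs ! j \<in> set cs" using xc 3 cs' nth_mem by metis
      then have "xs ! j = T ! r"
        using tail_dominator_cycle[OF T(1), of r] 3 ij r xt[of l] by simp
      then have "r = 0" using T_outside[OF T(1), of r] \<open>xs ! j \<in> set cs\<close> 3 r by auto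
      then have "cs' ! j = cs' ! (g - 1)" using att xc 3 \<open>xs ! j = T ! r\<close> by simp
      then have "j = g - 1"
        using cyc' cs' 3(4) g3 by (simp add: cycle_list_def nth_eq_iff_index_eq)
      then show ?thesis using r 3 \<open>r = 0\<close> by (simp add: core_adjacent_def)
    next
      case (4 l r)
      then have "r = Suc l \<or> l = Suc r"
        using tail_dominator_tail[OF T(1), of l r] ij xt by simp
      then show ?thesis using 4 by (auto simp: core_adjacent_def)
    qed
  qed
  show ?thesis
  proof (rule that[of xs])
    show "set xs \<subseteq> pverts G"
      using set_xs cs_verts T_verts[OF T(1)] by (metis UnE in_set_conv_nth subset_iff)
    show "g \<le> length xs" by (simp add: len)
    show "last xs = z"
    proof -
      have "length T - 1 < length T" using T_ne[OF T(1)] by simp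
      then have "xs ! (length xs - 1) = T ! (length T - 1)" using xt[of "length T - 1"] len g3 by simp
      then show ?thesis using T(2) T_ne[OF T(1)] len g3 by (metis last_conv_nth list.size(3) not_numeral_le_zero trans_le_add1)
    qed
    show "(xs ! (g - 1), xs ! 0) \<in> parcs G"
    proof -
      have "g - 1 < length cs'" using cs' g3 by simp
      then have "(cs' ! (g - 1), cs' ! (Suc (g - 1) mod length cs')) \<in> parcs G"
        using cyc' unfolding cycle_list_def by blast
      moreover have "Suc (g - 1) mod length cs' = 0" using cs' g3 by simp
      ultimately show ?thesis using xc g3 by simp
    qed
    show "u = v" if "u \<in> set xs" "v \<in> set xs" "u \<notin> S" "v \<notin> S" "s u = s v" "s u \<notin> set xs" for u v
      using common_dominator_in_core[OF T(1), of u v] that unfolding set_xs by blast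
  qed (use dist arc adj in auto)
qed

end

section \<open>Comparison with \<open>U n k g\<close>\<close>

lemma qform_split:
  assumes "pair_graph G" "D \<subseteq> parcs G" "D \<inter> D\<inverse> = {}"
  shows "qform G x = (\<Sum>(u, v)\<in>D. (x u + x v)\<^sup>2)
    + (\<Sum>(u, v)\<in>parcs G - (D \<union> D\<inverse>). (x u + x v)\<^sup>2) / 2"
proof -
  interpret pair_graph G by fact
  let ?F = "\<lambda>(u, v). (x u + x v)\<^sup>2"
  have fin: "finite D" using assms(2) pair_finite_arcs finite_subset by blast
  have conv: "D\<inverse> \<subseteq> parcs G" using assms(2) arcs_symmetric by auto
  have "sum ?F (D\<inverse>) = sum ?F D"
    by (rule sum.reindex_bij_witness[of _ prod.swap prod.swap]) (auto simp: add.commute)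
  then have "sum ?F (D \<union> D\<inverse>) = 2 * sum ?F D"
    using fin assms(3) by (simp add: sum.union_disjoint)
  moreover have "sum ?F (parcs G) = sum ?F (parcs G - (D \<union> D\<inverse>)) + sum ?F (D \<union> D\<inverse>)"
    using pair_finite_arcs assms(2) conv by (intro sum.subset_diff) auto
  ultimately show ?thesis unfolding qform_def by simp
qed

text \<open>The edges in \<open>D\<close> account for all the energy, so every other square
  vanishes. In the equality case this controls the further edges of \<open>G\<close>.\<close>

lemma qform_split_eq:
  assumes "pair_graph G" "D \<subseteq> parcs G" "D \<inter> D\<inverse> = {}"
    and le: "qform G x \<le> (\<Sum>(u, v)\<in>D. (x u + x v)\<^sup>2)"
    and uv: "(u, v) \<in> parcs G" "(u, v) \<notin> D" "(v, u) \<notin> D"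
  shows "x u + x v = 0"
proof -
  interpret pair_graph G by fact
  let ?F = "\<lambda>(u, v). (x u + x v)\<^sup>2"
  have "sum ?F (parcs G - (D \<union> D\<inverse>)) \<le> 0"
    using qform_split[OF assms(1-3), of x] le by simp
  moreover have "?F (u, v) \<le> sum ?F (parcs G - (D \<union> D\<inverse>))"
    using uv pair_finite_arcs by (intro member_le_sum) auto
  ultimately have "?F (u, v) \<le> 0" by linarith
  then show ?thesis by simp
qed

section \<open>Isomorphism invariance of the least eigenvalue\<close>

lemma digraph_iso_pair_iff:
  assumes G: "pair_graph G" and H: "pair_graph H"
  shows "digraph_iso (with_proj G) (with_proj H) \<longleftrightarrow>
    (\<exists>\<phi>. bij_betw \<phi> (pverts G) (pverts H) \<and> map_prod \<phi> \<phi> ` parcs G = parcs H)"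
proof
  assume "digraph_iso (with_proj G) (with_proj H)"
  then obtain h where h: "pre_digraph.digraph_isomorphism (with_proj G) h"
    and eq: "with_proj H = app_iso h (with_proj G)"
    unfolding digraph_iso_def by blast
  have verts: "pverts H = iso_verts h ` pverts G"
    using arg_cong[OF eq, of verts] by simp
  have arcs: "parcs H = iso_arcs h ` parcs G"
    using arg_cong[OF eq, of arcs] by simp
  have ends: "fst = iso_tail h" "snd = iso_head h"
    using arg_cong[OF eq, of tail] arg_cong[OF eq, of head] by simp_all
  have inj: "inj_on (iso_verts h) (pverts G)"
    and tl: "\<And>a. a \<in> parcs G \<Longrightarrow> iso_verts h (fst a) = fst (iso_arcs h a)"
    and hd: "\<And>a. a \<in> parcs G \<Longrightarrow> iso_verts h (snd a) = snd (iso_arcs h a)"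
    using h unfolding pre_digraph.digraph_isomorphism_def by (simp_all add: ends)
  have "map_prod (iso_verts h) (iso_verts h) ` parcs G = iso_arcs h ` parcs G"
    by (intro image_cong refl) (auto simp: prod_eq_iff tl hd)
  then show "\<exists>\<phi>. bij_betw \<phi> (pverts G) (pverts H) \<and> map_prod \<phi> \<phi> ` parcs G = parcs H"
    using inj verts arcs by (intro exI[of _ "iso_verts h"]) (auto simp: bij_betw_def)
next
  interpret pair_graph G by (rule G)
  assume "\<exists>\<phi>. bij_betw \<phi> (pverts G) (pverts H) \<and> map_prod \<phi> \<phi> ` parcs G = parcs H"
  then obtain \<phi> where \<phi>: "inj_on \<phi> (pverts G)" "\<phi> ` pverts G = pverts H"
    "map_prod \<phi> \<phi> ` parcs G = parcs H"
    by (auto simp: bij_betw_def)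
  define h where "h = \<lparr>iso_verts = \<phi>, iso_arcs = map_prod \<phi> \<phi>, iso_head = snd, iso_tail = fst\<rparr>"
  have "inj_on (map_prod \<phi> \<phi>) (parcs G)"
    using \<phi>(1) in_arcsD1 in_arcsD2 by (auto simp: inj_on_def)
  then have "pre_digraph.digraph_isomorphism (with_proj G) h"
    unfolding pre_digraph.digraph_isomorphism_def h_def using \<phi>(1) wf_digraph_axioms by simp
  moreover have "with_proj H = app_iso h (with_proj G)"
    unfolding with_proj_def app_iso_def h_def using \<phi> by simp
  ultimately show "digraph_iso (with_proj G) (with_proj H)"
    unfolding digraph_iso_def by blast
qed

lemma q_min_iso:
  assumes G: "pair_graph G" "pverts G \<noteq> {}" and H: "pair_graph H"
    and iso: "digraph_iso (with_proj G) (with_proj H)"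
  shows "q_min G = q_min H"
proof -
  obtain \<phi> where \<phi>: "bij_betw \<phi> (pverts G) (pverts H)" "map_prod \<phi> \<phi> ` parcs G = parcs H"
    using iso digraph_iso_pair_iff[OF G(1) H] by blast
  define \<psi> where "\<psi> = the_inv_into (pverts G) \<phi>"
  have Q: "qform H x = qform G (x \<circ> \<phi>)" "sqnorm H x = sqnorm G (x \<circ> \<phi>)" for x
    using qform_bij[OF bij_betw_imp_inj_on[OF \<phi>(1)] G(1) \<phi>(2)] sqnorm_bij[OF \<phi>(1)] by auto
  obtain x where x: "sqnorm G x = 1" "qform G x = q_min G"
    using q_min_attained[OF G] by blast
  have inv: "((x \<circ> \<psi>) \<circ> \<phi>) v = x v" if "v \<in> pverts G" for v
    using \<phi>(1) that by (simp add: \<psi>_def the_inv_into_f_f bij_betw_def)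
  have "q_min H = q_min G"
  proof (rule q_min_eqI[OF H])
    show "q_min G * sqnorm H y \<le> qform H y" for y
      unfolding Q by (rule q_min_le_qform[OF G])
    have "sqnorm G (x \<circ> \<psi> \<circ> \<phi>) = sqnorm G x"
      unfolding sqnorm_def using inv by (intro sum.cong) auto
    then have "sqnorm H (x \<circ> \<psi>) = sqnorm G x" unfolding Q(2) .
    moreover have "qform H (x \<circ> \<psi>) = qform G x"
      unfolding Q(1) using inv by (intro qform_cong[OF G(1)])
    ultimately show "sqnorm H (x \<circ> \<psi>) \<noteq> 0" "qform H (x \<circ> \<psi>) = q_min G * sqnorm H (x \<circ> \<psi>)"
      using x by simp_all
  qed
  then show ?thesis by simp
qed

text \<open>\<open>zs\<close> enumerates the vertices with the core \<open>xs\<close> first, so that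
  positions become vertices of the comparison graph. The last core vertex, where
  \<open>\<bar>x\<bar>\<close> is largest on \<open>S\<close>, becomes the star centre unless the
  core is all of \<open>G\<close>.\<close>

locale core_comparison = dominated_odd_cycle G S g cs s
  for G :: "'a pair_pre_digraph" and S g cs s +
  fixes xs zs :: "'a list" and n :: nat and x :: "'a \<Rightarrow> real"
  assumes gn: "g < n" and zs: "distinct zs" "set zs = pverts G" "length zs = n"
    and xs: "take (length xs) zs = xs" "g \<le> length xs"
    and xs_arc: "\<And>i. Suc i < length xs \<Longrightarrow> (xs ! i, xs ! Suc i) \<in> parcs G"
    and xs_close: "(xs ! (g - 1), xs ! 0) \<in> parcs G"
    and xs_dom: "\<And>i j. i < length xs \<Longrightarrow> j < length xs \<Longrightarrow> xs ! i \<notin> S \<Longrightarrow> s (xs ! i) = xs ! j \<Longrightarrow>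
      core_adjacent i j"
    and xs_inj: "\<And>u v. u \<in> set xs \<Longrightarrow> v \<in> set xs \<Longrightarrow> u \<notin> S \<Longrightarrow> v \<notin> S \<Longrightarrow> s u = s v \<Longrightarrow>
      s u \<notin> set xs \<Longrightarrow> u = v"
    and last_S: "last xs \<in> S"
    and last_max: "\<And>v. v \<in> S \<Longrightarrow> \<bar>x v\<bar> \<le> \<bar>x (last xs)\<bar>"
    and x_norm: "sqnorm G x = 1" and x_min: "qform G x = q_min G"
begin

definition c :: nat where "c = length xs"

text \<open>If the core is all of \<open>G\<close>, no vertex is left to be a leaf; the last core
  vertex is then regarded as the single leaf, so \<open>k\<close> is at least 1.\<close>

definition k :: nat where "k = max 1 (n - c)"

definition L :: nat where "L = n - k"

definition f :: "nat \<Rightarrow> 'a" where "f i = zs ! i"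

lemma gc: "g \<le> c" and cn: "c \<le> n"
proof -
  show "g \<le> c" using xs by (simp add: c_def)
  show "c \<le> n" using xs(1) zs(3) unfolding c_def by (metis length_take min.cobounded1)
qed

sublocale W: lollipop_star n k g L
  using odd_g g3 gn gc by unfold_locales (auto simp: k_def L_def)

lemma L_cases:
  obtains "c < n" "L = c" | "c = n" "L = n - 1"
  using cn by (cases "c < n") (auto simp: L_def k_def)

lemma f_core: "i < c \<Longrightarrow> f i = xs ! i"
  unfolding f_def c_def using xs(1) by (metis nth_take)

lemma f_eq_iff: "i < n \<Longrightarrow> j < n \<Longrightarrow> f i = f j \<longleftrightarrow> i = j"
  unfolding f_def using zs by (simp add: nth_eq_iff_index_eq)

lemma bij_f: "bij_betw f {0..<n} (pverts G)"
  unfolding f_def using bij_betw_nth[OF zs(1) refl zs(2)[symmetric]] zs(3) by (simp add: atLeast0LessThan)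

lemma f_verts: "i < n \<Longrightarrow> f i \<in> pverts G"
  using bij_f by (auto simp: bij_betw_def)

lemma f_surj: "v \<in> pverts G \<Longrightarrow> \<exists>i<n. v = f i"
  using bij_f unfolding bij_betw_def by (metis atLeastLessThan_iff imageE)

lemma set_xs: "set xs = f ` {..<c}"
  using f_core by (auto simp: c_def set_conv_nth image_iff)

lemma f_in_xs: "i < n \<Longrightarrow> f i \<in> set xs \<longleftrightarrow> i < c"
proof -
  assume i: "i < n"
  have "i < c" if "f i \<in> set xs"
  proof -
    obtain j where "j < c" "f i = f j" using \<open>f i \<in> set xs\<close> unfolding set_xs by blast
    then show ?thesis using f_eq_iff[of i j] i cn by simp
  qed
  then show ?thesis unfolding set_xs by blast
qed

lemma f_last: "f (c - 1) = last xs"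
proof -
  have "c - 1 < c" using gc g3 by simp
  then have "f (c - 1) = xs ! (length xs - 1)" "xs \<noteq> []" using f_core by (auto simp: c_def)
  then show ?thesis by (simp add: last_conv_nth)
qed

lemma core_adjacent_U:
  assumes "core_adjacent i j" "i < c" "j < c"
  shows "(i, j) \<in> parcs (U n k g)"
proof -
  interpret P: pair_graph "U n k g" by (rule W.pair_graph_U)
  have *: "(a, Suc a) \<in> parcs (U n k g)" if a: "Suc a < c" for a
  proof (cases "Suc a < L")
    case True
    then show ?thesis by (simp add: W.U_arc_iff)
  next
    \<comment> \<open>This happens when the core is all of \<open>G\<close>: its last edge is then
      the star edge.\<close>
    case False
    then have "a = L - 1" "L \<le> Suc a" "Suc a < n" using a by (cases rule: L_cases; linarith)+
    then show ?thesis unfolding W.U_arc_iff by blast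
  qed
  from assms(1) consider "j = Suc i" | "i = Suc j" | "i = 0" "j = g - 1" | "i = g - 1" "j = 0"
    unfolding core_adjacent_def by blast
  then show ?thesis
  proof cases
    case 1
    then show ?thesis using *[of i] assms by simp
  next
    case 2
    then show ?thesis using P.arcs_symmetric[OF *[of j]] assms by simp
  qed (simp_all add: W.U_arc_iff)
qed

text \<open>A dominator outside the core is replaced by the core vertex it serves. By
  \<open>xs_inj\<close> it serves only one, so \<open>?h\<close> maps \<open>S'\<close> injectively
  into \<open>S\<close>. Vertices outside the core are dominated by the last core vertex, which lies
  in \<open>S\<close>.\<close>

lemma domination_number_U_le: "domination_number (U n k g) \<le> card S"
proof -
  define S' where "S' = {i. i < c \<and> (f i \<in> S \<or> s (f i) \<notin> set xs)}"
  have dom': "s (f i) \<in> S \<and> (f i, s (f i)) \<in> parcs G" if "i < n" "f i \<notin> S" for i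
    using dom f_verts that by blast
  have "dominating_set (U n k g) S'"
    unfolding dominating_set_def
  proof (intro conjI ballI)
    show "S' \<subseteq> pverts (U n k g)" using cn by (auto simp: S'_def)
    fix i assume i: "i \<in> pverts (U n k g) - S'"
    show "\<exists>j\<in>S'. (i, j) \<in> parcs (U n k g)"
    proof (cases "i < c")
      case True
      then have iS: "f i \<notin> S" "s (f i) \<in> set xs" using i by (auto simp: S'_def)
      then obtain j where j: "j < c" "s (f i) = f j" unfolding set_xs by auto
      then have "core_adjacent i j" using xs_dom[of i j] True iS f_core by (simp add: c_def)
      moreover have "j \<in> S'" using dom'[of i] iS j i by (simp add: S'_def)
      ultimately show ?thesis using core_adjacent_U True j by blast
    next
      case False
      have cL: "L = c" using False i by (cases rule: L_cases) auto
      then have "(i, L - 1) \<in> parcs (U n k g)" using False i by (simp add: W.U_arc_iff)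
      moreover have "L - 1 \<in> S'" using f_last last_S cL gc g3 by (simp add: S'_def)
      ultimately show ?thesis by blast
    qed
  qed
  then have "domination_number (U n k g) \<le> card S'"
    by (intro domination_number_le) auto
  also have "\<dots> \<le> card S"
  proof (rule card_inj_on_le)
    let ?h = "\<lambda>i. if f i \<in> S then f i else s (f i)"
    show "?h ` S' \<subseteq> S" using dom' cn by (auto simp: S'_def)
    show "finite S" using S_verts pair_finite_verts finite_subset by blast
    show "inj_on ?h S'"
    proof (rule inj_onI)
      fix i j assume ij: "i \<in> S'" "j \<in> S'" "?h i = ?h j"
      have lt: "i < n" "j < n" "i < c" "j < c" using ij cn by (auto simp: S'_def)
      have mem: "f i \<in> set xs" "f j \<in> set xs" using lt f_in_xs by auto
      have out: "f i \<notin> S \<Longrightarrow> s (f i) \<notin> set xs" "f j \<notin> S \<Longrightarrow> s (f j) \<notin> set xs"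
        using ij by (auto simp: S'_def)
      have "f i = f j"
        using ij(3) xs_inj[OF mem] out mem by (auto split: if_splits)
      then show "i = j" using f_eq_iff lt by simp
    qed
  qed
  finally show ?thesis .
qed

section \<open>The vector transplanted to the comparison graph\<close>

definition sg :: real where "sg = (if x (last xs) \<ge> 0 then 1 else -1)"

text \<open>For \<open>f i\<close> outside \<open>S\<close>, its square is the energy of the edge to
  the dominator.\<close>

definition excess :: "nat \<Rightarrow> real" where "excess i = \<bar>x (f i) + x (s (f i))\<bar>"

text \<open>Among the values giving the leaf edge the prescribed energy, the one of sign opposite to
  \<open>x (last xs)\<close> has the largest absolute value.\<close>

definition y :: "nat \<Rightarrow> real" where
  "y i = (if i < c then x (f i) else if f i \<in> S then - x (last xs)
    else - sg * (\<bar>x (last xs)\<bar> + excess i))"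

text \<open>The edges of \<open>G\<close> whose energy \<open>y\<close> reproduces, in one
  orientation each.\<close>

definition D :: "('a \<times> 'a) set" where
  "D = (\<lambda>i. (f i, f (Suc i))) ` {..<c - 1} \<union> {(f (g - 1), f 0)}
     \<union> (\<lambda>i. (f i, s (f i))) ` {i. c \<le> i \<and> i < n \<and> f i \<notin> S}"

lemma D_arcs: "D \<subseteq> parcs G"
proof -
  have "(f i, f (Suc i)) \<in> parcs G" if "i < c - 1" for i
    using xs_arc[of i] f_core that by (simp add: c_def)
  moreover have "(f (g - 1), f 0) \<in> parcs G" using xs_close f_core gc g3 by simp
  moreover have "(f i, s (f i)) \<in> parcs G" if "i < n" "f i \<notin> S" for i
    using dom f_verts that by blast
  ultimately show ?thesis unfolding D_def by auto
qed

text \<open>Core edges are told apart by their positions. Edges to dominators start outside the core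
  and run from outside \<open>S\<close> into \<open>S\<close>, so none is the reverse of a core edge
  or of another such edge.\<close>

lemma D_disjoint: "D \<inter> D\<inverse> = {}"
proof -
  have core: False if "Suc i < c" "Suc j < c" "f i = f (Suc j)" "f (Suc i) = f j" for i j
    using that cn f_eq_iff[of i "Suc j"] f_eq_iff[of "Suc i" j] by simp
  have close: False if "Suc i < c" "f i = f 0" "f (Suc i) = f (g - 1)" for i
  proof -
    have "i = 0" using that(1,2) cn f_eq_iff[of i 0] by simp
    moreover have "g - 1 < n" "Suc 0 < n" using gn g3 by linarith+
    ultimately have "Suc 0 = g - 1" using that(3) f_eq_iff[of "Suc 0" "g - 1"] by simp
    then show False using g3 by simp
  qed
  have close': False if "f (g - 1) = f 0"
  proof -
    have "g - 1 < n" "0 < n" "g - 1 \<noteq> 0" using gn g3 by linarith+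
    then show False using f_eq_iff[of "g - 1" 0] that by metis
  qed
  have mixed: "f i \<noteq> f j" if "c \<le> i" "i < n" "j < c" for i j
    using that cn f_eq_iff[of i j] by simp
  have out: "f i \<noteq> s (f j)" if "i < n" "f i \<notin> S" "j < n" "f j \<notin> S" for i j
    using that dom f_verts by metis
  have "(b, a) \<notin> D" if ab: "(a, b) \<in> D" for a b
  proof
    assume ba: "(b, a) \<in> D"
    from ab consider i where "Suc i < c" "a = f i" "b = f (Suc i)" | "a = f (g - 1)" "b = f 0"
      | i where "c \<le> i" "i < n" "f i \<notin> S" "a = f i" "b = s (f i)"
      unfolding D_def by force
    note A = this
    from ba consider i where "Suc i < c" "b = f i" "a = f (Suc i)" | "b = f (g - 1)" "a = f 0"
      | i where "c \<le> i" "i < n" "f i \<notin> S" "b = f i" "a = s (f i)"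
      unfolding D_def by force
    note B = this
    have gc': "g - 1 < c" "0 < c" using gc g3 by auto
    show False
    proof (cases rule: A)
      case (1 i)
      show False
      proof (cases rule: B)
        case (1 j)
        then show False using core[of i j] \<open>Suc i < c\<close> \<open>a = f i\<close> \<open>b = f (Suc i)\<close> by simp
      next
        case 2
        then show False using close[of i] 1 by simp
      next
        case (3 j)
        then show False using mixed[of j "Suc i"] 1 by simp
      qed
    next
      case 2
      show False
      proof (cases rule: B)
        case (1 j)
        then show False using close[of j] 2 by simp
      next
        case 2
        then show False using close' \<open>a = f (g - 1)\<close> by simp
      next
        case (3 j)
        then show False using mixed[of j 0] 2 gc' by simp
      qed
    next
      case (3 i)
      show False
      proof (cases rule: B)
        case (1 j)
        then show False using mixed[of i "Suc j"] 3 by simp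
      next
        case 2
        then show False using mixed[of i 0] 3 gc' by simp
      next
        case (3 j)
        then show False using out[of i j] \<open>a = f i\<close> \<open>i < n\<close> \<open>f i \<notin> S\<close> by simp
      qed
    qed
  qed
  then show ?thesis by auto
qed

lemma sum_D: "(\<Sum>(u, v)\<in>D. (x u + x v)\<^sup>2) = (\<Sum>i<c - 1. (x (f i) + x (f (Suc i)))\<^sup>2)
    + (x (f (g - 1)) + x (f 0))\<^sup>2 + (\<Sum>i = c..<n. if f i \<in> S then 0 else (excess i)\<^sup>2)"
proof -
  let ?F = "\<lambda>(u, v). (x u + x v)\<^sup>2"
  let ?A = "(\<lambda>i. (f i, f (Suc i))) ` {..<c - 1}"
  let ?I = "{i. c \<le> i \<and> i < n \<and> f i \<notin> S}"
  let ?C = "(\<lambda>i. (f i, s (f i))) ` ?I"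
  have injA: "inj_on (\<lambda>i. (f i, f (Suc i))) {..<c - 1}"
    using f_eq_iff cn by (auto simp: inj_on_def)
  have injC: "inj_on (\<lambda>i. (f i, s (f i))) ?I"
    using f_eq_iff by (auto simp: inj_on_def)
  have AB: "?A \<inter> {(f (g - 1), f 0)} = {}"
    using f_eq_iff cn gc g3 by auto
  have ABC: "(?A \<union> {(f (g - 1), f 0)}) \<inter> ?C = {}"
    using f_eq_iff cn gc g3 by auto
  have "sum ?F D = sum ?F ?A + ?F (f (g - 1), f 0) + sum ?F ?C"
    unfolding D_def using AB ABC by (subst sum.union_disjoint, auto)+
  also have "sum ?F ?A = (\<Sum>i<c - 1. (x (f i) + x (f (Suc i)))\<^sup>2)"
    by (subst sum.reindex[OF injA]) simp
  also have "sum ?F ?C = (\<Sum>i\<in>?I. (excess i)\<^sup>2)"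
    by (subst sum.reindex[OF injC]) (simp add: excess_def)
  also have "\<dots> = (\<Sum>i = c..<n. if f i \<in> S then 0 else (excess i)\<^sup>2)"
    by (rule sum.mono_neutral_cong_left) auto
  finally show ?thesis by simp
qed

lemma leaf_energy:
  assumes "c \<le> i"
  shows "(x (last xs) + y i)\<^sup>2 = (if f i \<in> S then 0 else (excess i)\<^sup>2)"
  using assms by (auto simp: y_def sg_def power2_eq_square)

lemma qform_U_y: "qform (U n k g) y = (\<Sum>(u, v)\<in>D. (x u + x v)\<^sup>2)"
proof -
  have yc: "y i = x (f i)" if "i < c" for i using that by (simp add: y_def)
  have close: "y (g - 1) + y 0 = x (f (g - 1)) + x (f 0)" using gc g3 by (simp add: yc)
  show ?thesis
  proof (cases rule: L_cases)
    case 1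
    have "(\<Sum>i<L - 1. (y i + y (Suc i))\<^sup>2) = (\<Sum>i<c - 1. (x (f i) + x (f (Suc i)))\<^sup>2)"
      using 1 by (intro sum.cong) (auto simp: yc)
    moreover have "y (L - 1) = x (last xs)" using 1 yc[of "c - 1"] f_last gc g3 by simp
    then have "(\<Sum>j = L..<n. (y (L - 1) + y j)\<^sup>2) = (\<Sum>i = c..<n. if f i \<in> S then 0 else (excess i)\<^sup>2)"
      using 1 by (intro sum.cong) (auto simp: leaf_energy)
    ultimately show ?thesis unfolding W.qform_U sum_D close by simp
  next
    case 2
    \<comment> \<open>The core is all of \<open>G\<close>: its last edge is the only star edge, and
      no vertex outside contributes.\<close>
    have "{L..<n} = {L}" "Suc (L - 1) = L" using 2 gn W.gL g3 by auto
    then have "(\<Sum>i<L - 1. (y i + y (Suc i))\<^sup>2) + (\<Sum>j = L..<n. (y (L - 1) + y j)\<^sup>2)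
        = (\<Sum>i\<in>insert (L - 1) {..<L - 1}. (y i + y (Suc i))\<^sup>2)" by simp
    also have "\<dots> = (\<Sum>i<c - 1. (x (f i) + x (f (Suc i)))\<^sup>2)"
      using 2 \<open>Suc (L - 1) = L\<close> by (intro sum.cong) (auto simp: yc)
    finally show ?thesis unfolding W.qform_U sum_D close using 2 by simp
  qed
qed

text \<open>By the triangle inequality \<open>\<bar>x (f i)\<bar>\<close> is at most
  \<open>excess i\<close> plus the absolute value at the dominator, and the latter is at most
  \<open>\<bar>x (last xs)\<bar>\<close>.\<close>

lemma abs_y_ge:
  assumes "i < n"
  shows "\<bar>x (f i)\<bar> \<le> \<bar>y i\<bar>"
proof -
  have "\<bar>x (s (f i))\<bar> \<le> \<bar>x (last xs)\<bar>" if "f i \<notin> S"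
    using dom f_verts assms that last_max by blast
  then show ?thesis
    using last_max[of "f i"] by (auto simp: y_def sg_def excess_def)
qed

lemma sqnorm_G: "sqnorm G v = (\<Sum>i<n. (v (f i))\<^sup>2)"
  unfolding sqnorm_def using sum.reindex_bij_betw[OF bij_f, of "\<lambda>u. (v u)\<^sup>2"]
  by (simp add: atLeast0LessThan)

lemma sqnorm_y_ge: "1 \<le> sqnorm (U n k g) y"
  unfolding x_norm[symmetric] sqnorm_G W.sqnorm_U
  by (intro sum_mono) (simp add: abs_y_ge abs_le_square_iff[symmetric])

lemma qform_y_le: "qform (U n k g) y \<le> q_min G"
  unfolding qform_U_y x_min[symmetric] qform_split[OF pair_graph D_arcs D_disjoint]
  by (auto intro!: sum_nonneg)

text \<open>The energy did not increase and the norm did not decrease; since the least eigenvalue is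
  positive, this bounds it by \<open>q_min G\<close>.\<close>

lemma q_min_U_le: "q_min (U n k g) \<le> q_min G"
proof -
  have "q_min (U n k g) * 1 \<le> q_min (U n k g) * sqnorm (U n k g) y"
    using W.q_pos sqnorm_y_ge by (intro mult_left_mono) auto
  then show ?thesis using W.q_le[of y] qform_y_le by linarith
qed

section \<open>The case of equality\<close>

context
  assumes tight: "q_min G = q_min (U n k g)"
begin

lemma y_minimizer: "qform (U n k g) y = q_min (U n k g) * sqnorm (U n k g) y"
  and sqnorm_y: "sqnorm (U n k g) y = 1"
  and qform_y: "qform (U n k g) y = q_min G"
proof -
  have "q_min (U n k g) * sqnorm (U n k g) y \<le> q_min (U n k g) * 1"
    using W.q_le[of y] qform_y_le tight by linarith
  then show N: "sqnorm (U n k g) y = 1" using W.q_pos sqnorm_y_ge by simp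
  then show "qform (U n k g) y = q_min G"
    using W.q_le[of y] qform_y_le tight by simp
  then show "qform (U n k g) y = q_min (U n k g) * sqnorm (U n k g) y"
    using N tight by simp
qed

lemma y_pos: "0 < sqnorm (U n k g) y"
  using sqnorm_y by simp

lemma abs_y_eq: "i < n \<Longrightarrow> \<bar>x (f i)\<bar> = \<bar>y i\<bar>"
proof -
  assume i: "i < n"
  have "(\<Sum>i<n. (y i)\<^sup>2 - (x (f i))\<^sup>2) = 0"
    using sqnorm_y x_norm unfolding W.sqnorm_U sqnorm_G sum_subtractf by simp
  moreover have "0 \<le> (y i)\<^sup>2 - (x (f i))\<^sup>2" if "i < n" for i
    using abs_y_ge[OF that] by (simp add: abs_le_square_iff)
  ultimately have "(y i)\<^sup>2 - (x (f i))\<^sup>2 = 0"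
    using i by (subst (asm) sum_nonneg_eq_0_iff) auto
  then have "(x (f i))\<^sup>2 = (y i)\<^sup>2" by simp
  then show ?thesis by (simp add: power2_eq_iff abs_eq_iff)
qed

text \<open>A leaf in \<open>S\<close> would have the absolute value of the centre, but leaves
  strictly exceed it. Equality in the triangle inequality then gives the dominator the absolute
  value of the centre, which only the centre has within the core.\<close>

lemma leaf_dominator:
  assumes i: "c \<le> i" "i < n"
  shows "f i \<notin> S" "s (f i) = last xs" "y i = x (f i)"
proof -
  have cL: "L = c" using i by (cases rule: L_cases) auto
  have yL: "y (L - 1) = x (last xs)" using cL f_last gc g3 by (simp add: y_def)
  have big: "\<bar>x (last xs)\<bar> < \<bar>y j\<bar>" if "c \<le> j" "j < n" for j
    using W.minimizer_leaf(2)[OF y_minimizer y_pos, of j] that cL yL by simp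
  have notS: "f j \<notin> S" if "c \<le> j" "j < n" for j
    using big[OF that] that by (auto simp: y_def)
  show iS: "f i \<notin> S" by (rule notS[OF i])
  have si: "s (f i) \<in> S" using dom f_verts i iS by blast
  have ax: "\<bar>x (f i)\<bar> = \<bar>x (last xs)\<bar> + excess i"
    using abs_y_eq[OF i(2)] i iS by (auto simp: y_def sg_def excess_def)
  then have "\<bar>x (s (f i))\<bar> = \<bar>x (last xs)\<bar>"
    using last_max[OF si] unfolding excess_def by linarith
  moreover obtain j where j: "j < n" "s (f i) = f j" using f_surj S_verts si by blast
  moreover have "j < c" using notS[of j] si j by (metis not_le)
  ultimately have "\<bar>y j\<bar> = \<bar>y (L - 1)\<bar>" "j < L" using yL cL by (auto simp: y_def)
  then have "j = L - 1" using W.minimizer_center_unique[OF y_minimizer y_pos] by blast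
  then show s_last: "s (f i) = last xs" using j f_last cL by simp
  have "x (last xs) \<noteq> 0" using W.center_nonzero[OF y_minimizer y_pos] yL by simp
  \<comment> \<open>If both ends had the same sign, \<open>excess i\<close> would be the sum of
    their absolute values, and \<open>ax\<close> would give \<open>x (last xs) = 0\<close>.\<close>
  then have "x (f i) = - sg * (\<bar>x (last xs)\<bar> + excess i)"
    using ax unfolding excess_def s_last sg_def by (auto simp: abs_if split: if_splits)
  then show "y i = x (f i)" using i iS by (simp add: y_def)
qed

lemma y_eq: "i < n \<Longrightarrow> y i = x (f i)"
  using leaf_dominator(3)[of i] by (cases "i < c") (auto simp: y_def)

text \<open>Edges of the comparison graph come from \<open>D\<close>, up to orientation. Conversely
  an edge of \<open>G\<close> outside \<open>D\<close> would carry no energy, so its ends would have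
  opposite values, which a minimizer on \<open>U n k g\<close> never has.\<close>

lemma arcs_image: "map_prod f f ` parcs (U n k g) = parcs G"
proof
  have half: "(f i, f j) \<in> parcs G"
    if "j = Suc i \<and> j < L \<or> i = g - 1 \<and> j = 0 \<or> i = L - 1 \<and> L \<le> j \<and> j < n" for i j
  proof -
    have "Suc l < c \<Longrightarrow> (f l, f (Suc l)) \<in> parcs G" for l
      using D_arcs unfolding D_def by auto
    moreover have "(f (g - 1), f 0) \<in> parcs G" using D_arcs unfolding D_def by auto
    moreover have "L \<le> c" by (cases rule: L_cases) auto
    moreover have "(f (L - 1), f j) \<in> parcs G" if j: "L \<le> j" "j < n"
    proof (cases rule: L_cases)
      case 1
      then have "f j \<notin> S" "s (f j) = f (L - 1)" using leaf_dominator[of j] j f_last by auto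
      then show ?thesis using dom[OF f_verts[OF j(2)]] arcs_symmetric by auto
    next
      case 2
      then have "j = Suc (L - 1)" "Suc (L - 1) < c" using j gn W.gL g3 by auto
      then show ?thesis using calculation(1) by blast
    qed
    ultimately show ?thesis using that by auto
  qed
  have "(f i, f j) \<in> parcs G" if "(i, j) \<in> parcs (U n k g)" for i j
    using that half[of i j] half[of j i] arcs_symmetric unfolding W.U_arc_iff by blast
  then show "map_prod f f ` parcs (U n k g) \<subseteq> parcs G" by auto
next
  have inv: "(i, j) \<in> parcs (U n k g)" if "(f i, f j) \<in> D" "i < n" "j < n" for i j
  proof -
    from that(1) consider l where "Suc l < c" "f i = f l" "f j = f (Suc l)"
      | "f i = f (g - 1)" "f j = f 0"
      | l where "c \<le> l" "l < n" "f i = f l" "f j = s (f l)"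
      unfolding D_def by force
    then show ?thesis
    proof cases
      case (1 l)
      then have "i = l" "j = Suc l" using f_eq_iff[of i l] f_eq_iff[of j "Suc l"] that cn by auto
      then show ?thesis using 1 by (intro core_adjacent_U) (auto simp: core_adjacent_def)
    next
      case 2
      then have "i = g - 1" "j = 0" using f_eq_iff[of i "g - 1"] f_eq_iff[of j 0] that gn by auto
      then show ?thesis by (simp add: W.U_arc_iff)
    next
      case (3 l)
      have "L = c" using 3 by (cases rule: L_cases) auto
      have "f j = f (c - 1)" using 3 leaf_dominator(2)[of l] f_last by simp
      then have "i = l" "j = c - 1" using f_eq_iff[of i l] f_eq_iff[of j "c - 1"] 3 that by auto
      then show ?thesis using 3 \<open>L = c\<close> by (simp add: W.U_arc_iff)
    qed
  qed
  show "parcs G \<subseteq> map_prod f f ` parcs (U n k g)"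
  proof
    fix p assume p: "p \<in> parcs G"
    obtain u v where uv: "p = (u, v)" by (cases p)
    obtain i j where ij: "i < n" "j < n" "u = f i" "v = f j"
      using f_surj in_arcsD1 in_arcsD2 p uv by metis
    have "x u + x v \<noteq> 0"
      using W.minimizer_no_opposite[OF y_minimizer y_pos, of i j] ij y_eq by simp
    then have "(u, v) \<in> D \<or> (v, u) \<in> D"
      using qform_split_eq[OF pair_graph D_arcs D_disjoint, of x u v] p uv qform_y
      unfolding qform_U_y x_min by auto
    then have "(i, j) \<in> parcs (U n k g)"
    proof
      assume "(u, v) \<in> D"
      then show ?thesis using inv[of i j] ij by simp
    next
      assume "(v, u) \<in> D"
      then have "(j, i) \<in> parcs (U n k g)" using inv[of j i] ij by simp
      then show ?thesis unfolding W.U_arc_iff by blast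
    qed
    then show "p \<in> map_prod f f ` parcs (U n k g)" using uv ij by force
  qed
qed

lemma iso_U: "digraph_iso (with_proj G) (with_proj (U n k g))"
proof -
  define \<phi> where "\<phi> = the_inv_into {0..<n} f"
  have inv: "\<phi> (f i) = i" if "i < n" for i
    using bij_f that by (simp add: \<phi>_def the_inv_into_f_f bij_betw_def)
  have "bij_betw \<phi> (pverts G) (pverts (U n k g))"
    unfolding \<phi>_def using bij_betw_the_inv_into[OF bij_f] by simp
  moreover have "map_prod \<phi> \<phi> ` parcs G = parcs (U n k g)"
  proof -
    have "map_prod \<phi> \<phi> (map_prod f f p) = p" if "p \<in> parcs (U n k g)" for p
    proof -
      interpret P: pair_graph "U n k g" by (rule W.pair_graph_U)
      have "fst p < n" "snd p < n"
        using P.arc_fst_in_verts[OF that] P.arc_snd_in_verts[OF that] by auto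
      then show ?thesis using inv by (simp add: prod_eq_iff)
    qed
    then show ?thesis unfolding arcs_image[symmetric] by (force simp: image_image)
  qed
  ultimately show ?thesis
    using digraph_iso_pair_iff[OF pair_graph W.pair_graph_U] by blast
qed

end

end

section \<open>Choice of the data for the comparison, and the conclusion\<close>

lemma nonbipartite_class_comparison:
  fixes G :: "'a pair_pre_digraph"
  assumes G: "G \<in> nonbipartite_class n \<gamma> g" and g: "odd g" "3 \<le> g" "g < n"
  obtains k where "1 \<le> k" "k \<le> n - g" "domination_number (U n k g) \<le> \<gamma>"
    "q_min (U n k g) \<le> q_min G"
    "q_min G = q_min (U n k g) \<Longrightarrow> digraph_iso (with_proj G) (with_proj (U n k g))"
proof -
  have pg: "pair_graph G" and con: "Digraph_Component.connected (with_proj G)"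
    and nb: "\<not> bipartite G" and n: "card (pverts G) = n"
    and dn: "domination_number G = \<gamma>" and og: "odd_girth G = g"
    using G unfolding nonbipartite_class_def by auto
  interpret pair_graph G by (rule pg)
  have ne: "pverts G \<noteq> {}" using n g by auto
  obtain S where S: "dominating_set G S" "card S = \<gamma>"
    using domination_number_attained[OF pair_finite_verts] dn by blast
  obtain u m where um: "(u, u) \<in> parcs G ^^ m" "odd m"
    using not_bipartite_odd_closed_walk[OF pg con nb] by blast
  obtain cs0 where cs0: "cycle_list (parcs G) cs0 \<and> length cs0 = g"
    using odd_girth_cycle_list[OF pg um] og by blast
  \<comment> \<open>A bound on the overlap with \<open>S\<close>, needed for a cycle of largest
    overlap to exist.\<close>
  have "card (set cs \<inter> S) < Suc g" if "cycle_list (parcs G) cs \<and> length cs = g" for cs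
  proof -
    have "card (set cs \<inter> S) \<le> card (set cs)" by (intro card_mono) auto
    also have "\<dots> \<le> g" using that card_length by blast
    finally show ?thesis by simp
  qed
  then obtain cs where cs: "cycle_list (parcs G) cs" "length cs = g"
    and max: "\<And>cs'. cycle_list (parcs G) cs' \<Longrightarrow> length cs' = g \<Longrightarrow>
      card (set cs' \<inter> S) \<le> card (set cs \<inter> S)"
    using ex_has_greatest_nat[of "\<lambda>cs. cycle_list (parcs G) cs \<and> length cs = g" cs0
        "\<lambda>cs. card (set cs \<inter> S)" "Suc g"] cs0 by blast
  \<comment> \<open>A dominator on the cycle is preferred whenever there is one.\<close>
  have "\<exists>w. w \<in> S \<and> (v, w) \<in> parcs G \<and> ((\<exists>t\<in>set cs \<inter> S. (v, t) \<in> parcs G) \<longrightarrow> w \<in> set cs)"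
    if "v \<in> pverts G - S" for v
    using S(1) that unfolding dominating_set_def by blast
  then obtain s where s: "\<And>v. v \<in> pverts G - S \<Longrightarrow> s v \<in> S \<and> (v, s v) \<in> parcs G \<and>
      ((\<exists>t\<in>set cs \<inter> S. (v, t) \<in> parcs G) \<longrightarrow> s v \<in> set cs)"
    by metis
  interpret C: dominated_odd_cycle G S g cs s
  proof unfold_locales
    show "S \<subseteq> pverts G" using S(1) by (simp add: dominating_set_def)
    show "(u, v) \<in> (parcs G)\<^sup>*" if "u \<in> pverts G" "v \<in> pverts G" for u v
      using connected_rtrancl[OF pg con that] .
    show "g \<le> l" if "odd l" "(u, u) \<in> parcs G ^^ l" for u l
      using odd_girth_le[OF pg that(2,1)] og by simp
    show "s v \<in> set cs" if "v \<in> set cs" "v \<notin> S" "t \<in> set cs" "t \<in> S" "(v, t) \<in> parcs G" for v t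
      using s[of v] that in_arcsD1 by blast
  qed (use cs max g s in auto)
  obtain x where x: "sqnorm G x = 1" "qform G x = q_min G"
    using q_min_attained[OF pg ne] by blast
  have "finite S" using C.S_verts pair_finite_verts finite_subset by blast
  moreover have "S \<noteq> {}" using S(1) ne unfolding dominating_set_def by blast
  ultimately obtain z where z: "z \<in> S" "\<And>v. v \<in> S \<Longrightarrow> \<bar>x v\<bar> \<le> \<bar>x z\<bar>"
  proof -
    have "Max ((\<lambda>v. \<bar>x v\<bar>) ` S) \<in> (\<lambda>v. \<bar>x v\<bar>) ` S"
      using \<open>finite S\<close> \<open>S \<noteq> {}\<close> by (intro Max_in) auto
    then obtain w where "w \<in> S" "\<bar>x w\<bar> = Max ((\<lambda>v. \<bar>x v\<bar>) ` S)" by auto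
    then show ?thesis using that[of w] \<open>finite S\<close> by simp
  qed
  obtain xs where xs: "distinct xs" "set xs \<subseteq> pverts G" "g \<le> length xs" "last xs = z"
    and arcs: "\<And>i. Suc i < length xs \<Longrightarrow> (xs ! i, xs ! Suc i) \<in> parcs G"
      "(xs ! (g - 1), xs ! 0) \<in> parcs G"
    and dom: "\<And>i j. i < length xs \<Longrightarrow> j < length xs \<Longrightarrow> xs ! i \<notin> S \<Longrightarrow> s (xs ! i) = xs ! j \<Longrightarrow>
      C.core_adjacent i j"
    and inj: "\<And>u v. u \<in> set xs \<Longrightarrow> v \<in> set xs \<Longrightarrow> u \<notin> S \<Longrightarrow> v \<notin> S \<Longrightarrow> s u = s v \<Longrightarrow>
      s u \<notin> set xs \<Longrightarrow> u = v"
    using C.core_list_exists[of z] z(1) C.S_verts by blast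
  obtain ys where ys: "distinct ys" "set ys = pverts G - set xs"
    using finite_distinct_list[of "pverts G - set xs"] pair_finite_verts by auto
  have zs: "distinct (xs @ ys)" "set (xs @ ys) = pverts G" using xs ys by auto
  then have "length (xs @ ys) = n" using distinct_card n by metis
  then interpret K: core_comparison G S g cs s xs "xs @ ys" n x
    using zs xs arcs dom inj z x g by unfold_locales auto
  show ?thesis
    using that[of K.k] K.W.k1 K.W.kn K.domination_number_U_le S(2) K.q_min_U_le K.iso_U by blast
qed

theorem theorem3p9:
  fixes n g \<gamma> :: nat
  assumes "odd g" and "3 \<le> g" and "g < n"
    and "\<lceil>real g / 3\<rceil> \<le> int \<gamma>" and "\<gamma> \<le> domination_number (U n 1 g)"
  shows "V n \<gamma> g \<in> nonbipartite_class n \<gamma> g \<and>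
    (\<forall>G :: 'a pair_pre_digraph. G \<in> nonbipartite_class n \<gamma> g \<longrightarrow>
       q_min (V n \<gamma> g) \<le> q_min G \<and>
       (q_min G = q_min (V n \<gamma> g) \<longleftrightarrow> digraph_iso G (V n \<gamma> g)))"
proof -
  let ?P = "\<lambda>k. 1 \<le> k \<and> k \<le> n - g \<and> domination_number (U n k g) = \<gamma>"
  define k\<^sub>0 where "k\<^sub>0 = (LEAST k. ?P k)"
  have V: "V n \<gamma> g = U n k\<^sub>0 g" by (simp add: V_def k\<^sub>0_def)
  \<comment> \<open>From any \<open>k\<close> with domination number at most
    \<open>\<gamma>\<close>, the intermediate values lead down to one with exactly
    \<open>\<gamma>\<close>; this also makes the \<open>LEAST\<close> in \<open>V\<close>
    meaningful.\<close>
  have least: "k\<^sub>0 \<le> k \<and> ?P k\<^sub>0" if k: "1 \<le> k" "k \<le> n - g" "domination_number (U n k g) \<le> \<gamma>" for k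
  proof -
    obtain k' where k': "1 \<le> k'" "k' \<le> k" "domination_number (U n k' g) = \<gamma>"
      using domination_number_U_intermediate[OF assms(1-3) k assms(5)] by blast
    then have "?P k'" using k by simp
    then show ?thesis
      using LeastI[of ?P k'] Least_le[of ?P k'] k'(2) unfolding k\<^sub>0_def by simp
  qed
  \<comment> \<open>The lower bound on \<open>\<gamma>\<close> makes the largest star,
    \<open>k = n - g\<close>, a starting point for \<open>least\<close>.\<close>
  have "real g \<le> 3 * real \<gamma>" using assms(4) by (simp add: ceiling_le_iff)
  then have "g \<le> 3 * \<gamma>" by linarith
  then have "(g + 2) div 3 \<le> \<gamma>" by linarith
  then have "domination_number (U n (n - g) g) \<le> \<gamma>"
    using domination_number_U_max_star[OF assms(1-3)] by simp
  then have k0: "?P k\<^sub>0" using least[of "n - g"] assms(3) by simp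
  interpret W: lollipop_star n k\<^sub>0 g "n - k\<^sub>0"
    using assms k0 by unfold_locales auto
  have "V n \<gamma> g \<in> nonbipartite_class n \<gamma> g"
    using W.U_in_nonbipartite_class k0 V by simp
  moreover have "q_min (V n \<gamma> g) \<le> q_min G \<and>
      (q_min G = q_min (V n \<gamma> g) \<longleftrightarrow> digraph_iso G (V n \<gamma> g))"
    if G: "G \<in> nonbipartite_class n \<gamma> g" for G :: "'a pair_pre_digraph"
  proof -
    obtain k where k: "1 \<le> k" "k \<le> n - g" "domination_number (U n k g) \<le> \<gamma>"
      and le: "q_min (U n k g) \<le> q_min G"
      and iso: "q_min G = q_min (U n k g) \<Longrightarrow> digraph_iso (with_proj G) (with_proj (U n k g))"
      using nonbipartite_class_comparison[OF G assms(1-3)] by blast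
    have k0k: "k\<^sub>0 \<le> k" using least[OF k] by blast
    have mono: "q_min (U n k\<^sub>0 g) < q_min (U n k g)" if "k\<^sub>0 \<noteq> k"
      using q_min_U_strict_mono[OF assms(1-3), of k\<^sub>0 k] k0 k0k k(2) that by simp
    have "digraph_iso G (V n \<gamma> g)" if "q_min G = q_min (V n \<gamma> g)"
    proof -
      \<comment> \<open>A \<open>k\<close> above \<open>k\<^sub>0\<close> would put
        \<open>q_min G\<close> strictly above \<open>q_min (V n \<gamma> g)\<close>.\<close>
      have "k\<^sub>0 = k" using mono le that V by fastforce
      then show ?thesis using iso that V by simp
    qed
    moreover have "q_min G = q_min (V n \<gamma> g)" if "digraph_iso G (V n \<gamma> g)"
    proof (rule q_min_iso)
      show "pair_graph G" using G by (simp add: nonbipartite_class_def)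
      show "pverts G \<noteq> {}" using G assms(3) by (auto simp: nonbipartite_class_def)
    qed (use that V W.pair_graph_U in auto)
    moreover have "q_min (V n \<gamma> g) \<le> q_min G"
      using mono le V by (cases "k\<^sub>0 = k") auto
    ultimately show ?thesis by blast
  qed
  ultimately show ?thesis by blast
qed

end
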